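(* Let $r,n\ge1$ be integers, let $z=(z_1,\dots,z_n)\in\mathbb{C}^n$ have pairwise distinct coordinates, let $\Lambda=(\Lambda_1,\dots,\Lambda_n)$ with $\Lambda_s\in\mathfrak{h}^*$ be weights of $\mathfrak{gl}_{r+1}$, and let $l=(l_1,\dots,l_r)$ be nonnegative integers. Assume that the pair $\Lambda,l$ is separating. Let $t$ be a critical point of the master function $\Phi(\,\cdot\,;z;\Lambda;l)$, let $y_i(x)=\prod_{j=1}^{l_i}(x-t^{(i)}_j)$ for $i=1,\dots,r$, and let $D_t$ be the fundamental operator of $t$. Then: (i) All singular points of $D_t$ are regular and lie in $\{z_1,\dots,z_n,\infty\}$. The exponents of $D_t$ at $z_s$ are $-m_{s,1},\,-m_{s,2}+1,\,\dots,\,-m_{s,r+1}+r$ for $s=1,\dots,n$, and the exponents of $D_t$ at $\infty$ are $m_{\infty,1},\,m_{\infty,2}-1,\,\dots,\,m_{\infty,r+1}-r$. (ii) The differential equation $D_t u=0$ has solutions $u_1,\dots,u_{r+1}$ such that $u_1=y_1T_1$ and, for $i=2,\dots,r+1$, $$\mathrm{Wr}(u_1,\dots,u_i)=y_i\,T_i\,T_{i-1}\cdots T_1,$$ where $\mathrm{Wr}(u_1,\dots,u_i)$ denotes the Wronskian of $u_1,\dots,u_i$ and $y_{r+1}=1$.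
   Context: Lie algebra notation. $\mathfrak{gl}_{r+1}$ is the complex Lie algebra with standard generators $e_{a,b}$; $\mathfrak{h}=\oplus_a\mathbb{C}e_{a,a}$; $e^*_{1,1},\dots,e^*_{r+1,r+1}\in\mathfrak{h}^*$ is the basis dual to $e_{1,1},\dots,e_{r+1,r+1}$; $\alpha_a=e^*_{a,a}-e^*_{a+1,a+1}$ for $a=1,\dots,r$; $(\cdot,\cdot)$ is the (bilinear) scalar product on $\mathfrak{h}^*$ with $(e^*_{a,a},e^*_{b,b})=\delta_{a,b}$. Put $\Lambda_\infty=\sum_{s=1}^n\Lambda_s-\sum_{i=1}^r l_i\alpha_i$ and $m_{s,i}=\langle\Lambda_s,e_{i,i}\rangle$ for $s\in\{1,\dots,n,\infty\}$, $i=1,\dots,r+1$. Separating. The pair $\Lambda,l$ is separating if $(2\Lambda_\infty+\sum_{i=1}^r c_i\alpha_i,\ \sum_{i=1}^r c_i\alpha_i)+2\sum_{i=1}^r c_i\ne0$ for all sets of integers $\{c_1,\dots,c_r\}$ with $0\le c_i\le l_i$ and $\sum_i c_i\ne0$. Master function and critical points. In the variables $t=(t^{(1)}_1,\dots,t^{(1)}_{l_1},\dots,t^{(r)}_1,\dots,t^{(r)}_{l_r})$, the master function is the (multi-valued) function $$\Phi(t;z;\Lambda;l)=\prod_{i=1}^r\prod_{j=1}^{l_i}\prod_{s=1}^n(t^{(i)}_j-z_s)^{-(\Lambda_s,\alpha_i)}\prod_{i=1}^r\prod_{1\le j<s\le l_i}(t^{(i)}_j-t^{(i)}_s)^2\prod_{i=1}^{r-1}\prod_{j=1}^{l_i}\prod_{k=1}^{l_{i+1}}(t^{(i)}_j-t^{(i+1)}_k)^{-1}.$$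 A point $t$ with complex coordinates is a critical point of $\Phi(\,\cdot\,;z;\Lambda;l)$ if $(\Phi^{-1}\partial\Phi/\partial t^{(i)}_j)(t)=0$ for all $i,j$, that is, if all fractions below are well-defined at $t$ and, for all $i=1,\dots,r$, $j=1,\dots,l_i$ (with $l_0=l_{r+1}=0$), $$\sum_{s=1}^n\frac{(\Lambda_s,\alpha_i)}{t^{(i)}_j-z_s}-\sum_{s=1,\,s\ne j}^{l_i}\frac{2}{t^{(i)}_j-t^{(i)}_s}+\sum_{s=1}^{l_{i-1}}\frac1{t^{(i)}_j-t^{(i-1)}_s}+\sum_{s=1}^{l_{i+1}}\frac1{t^{(i)}_j-t^{(i+1)}_s}=0,$$ where terms with $(\Lambda_s,\alpha_i)=0$ are omitted. Fundamental operator. Let $T_i(x)=\prod_{s=1}^n(x-z_s)^{-m_{s,i}}$ for $i=1,\dots,r+1$ and $\ln'(f)=(df/dx)/f$. The fundamental operator of $t$ is the linear differential operator of order $r+1$ with rational coefficients $$D_t=\Big(\frac{d}{dx}-\ln'\Big(\frac{T_{r+1}}{y_r}\Big)\Big)\Big(\frac{d}{dx}-\ln'\Big(\frac{y_rT_r}{y_{r-1}}\Big)\Big)\cdots\Big(\frac{d}{dx}-\ln'\Big(\frac{y_2T_2}{y_1}\Big)\Big)\Big(\frac{d}{dx}-\ln'(y_1T_1)\Big).$$ Conventions. Exponents are listed as a multiset. Exponents at $\infty$ are taken with respect to the local parameter $1/x$, so a solution behaving like $x^{d}$ at $\infty$ corresponds to the exponent $-d$. Solutions are (possibly multi-valued)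 analytic functions. *)

theory Defs
  imports
    "HOL-Complex_Analysis.Complex_Analysis"
    "HOL-Computational_Algebra.Computational_Algebra"
    "HOL-Computational_Algebra.Field_as_Ring"
    "Jordan_Normal_Form.Determinant"
begin

section \<open>Rational functions of one complex variable\<close>

type_synonym ratfun = "complex poly fract"

abbreviation rat_const :: "complex \<Rightarrow> ratfun" where
  "rat_const c \<equiv> to_fract [:c:]"

abbreviation rat_X :: ratfun where
  "rat_X \<equiv> to_fract [:0, 1:]"

text \<open>\<^const>\<open>quot_of_fract\<close> returns numerator and denominator in lowest terms, so removable
  singularities are invisible to the next two definitions.\<close>

definition rat_pole :: "ratfun \<Rightarrow> complex \<Rightarrow> bool" where
  "rat_pole q p \<longleftrightarrow> poly (snd (quot_of_fract q)) p = 0"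

definition rat_eval :: "ratfun \<Rightarrow> complex \<Rightarrow> complex" where
  "rat_eval q p = poly (fst (quot_of_fract q)) p / poly (snd (quot_of_fract q)) p"

definition rat_deriv :: "ratfun \<Rightarrow> ratfun" where
  "rat_deriv q = (let (a, b) = quot_of_fract q in
     to_fract (pderiv a * b - a * pderiv b) / to_fract (b ^ 2))"

text \<open>The composition \<open>q(\<phi>(w))\<close>, for nonconstant \<open>\<phi>\<close>.\<close>

definition rat_comp :: "ratfun \<Rightarrow> ratfun \<Rightarrow> ratfun" where
  "rat_comp q \<phi> = (let (a, b) = quot_of_fract q in
     poly (map_poly rat_const a) \<phi> / poly (map_poly rat_const b) \<phi>)"

definition lnderiv :: "ratfun \<Rightarrow> ratfun" where
  "lnderiv f = rat_deriv f / f"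


section \<open>Linear differential operators with rational coefficients\<close>

text \<open>The operator \<open>\<Sum>\<^sub>k a\<^sub>k (d/dx)\<^sup>k\<close> is stored as the polynomial with coefficients \<open>a\<^sub>k\<close>; its order
  is the degree. Composition of operators is \<open>dop_comp\<close>, not the commutative product of
  polynomials.\<close>

type_synonym diffop = "ratfun poly"

text \<open>\<open>(d/dx) \<circ> A\<close>\<close>

definition ddx_comp :: "diffop \<Rightarrow> diffop" where
  "ddx_comp A = pCons 0 A + map_poly rat_deriv A"

definition dop_comp :: "diffop \<Rightarrow> diffop \<Rightarrow> diffop" where
  "dop_comp A B = (\<Sum>k\<le>degree A. Polynomial.smult (coeff A k) ((ddx_comp ^^ k) B))"

text \<open>The operator \<open>A\<close> rewritten in the variable \<open>w\<close>, where \<open>x = \<phi>(w)\<close> and hence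
  \<open>d/dx = (1/\<phi>'(w)) d/dw\<close>.\<close>

definition dop_pullback :: "ratfun \<Rightarrow> diffop \<Rightarrow> diffop" where
  "dop_pullback \<phi> A = (\<Sum>k\<le>degree A. Polynomial.smult (rat_comp (coeff A k) \<phi>)
     (((\<lambda>B. Polynomial.smult (1 / rat_deriv \<phi>) (ddx_comp B)) ^^ k) 1))"

subsection \<open>Singular points and exponents\<close>

datatype sphere_point = Pt complex | Infty

text \<open>The coordinate \<open>x\<close> as a function of the local parameter \<open>w\<close> at a point of the Riemann
  sphere: \<open>w = x - p\<close> at a finite point \<open>p\<close>, and \<open>w = 1/x\<close> at infinity.\<close>

fun local_coord :: "sphere_point \<Rightarrow> ratfun" where
  "local_coord (Pt p) = to_fract [:p, 1:]"
| "local_coord Infty = 1 / rat_X"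

definition local_op :: "diffop \<Rightarrow> sphere_point \<Rightarrow> diffop" where
  "local_op A P = (let B = dop_pullback (local_coord P) A
     in Polynomial.smult (inverse (lead_coeff B)) B)"

definition singular_point :: "diffop \<Rightarrow> sphere_point \<Rightarrow> bool" where
  "singular_point A P \<longleftrightarrow> (\<exists>k. rat_pole (coeff (local_op A P) k) 0)"

text \<open>In the monic operator \<open>(d/dw)\<^sup>N + \<Sum>\<^sub>k b\<^sub>k (d/dw)\<^sup>k\<close> the coefficient \<open>b\<^sub>k\<close> has a pole of
  order at most \<open>N - k\<close> at \<open>w = 0\<close>.\<close>

definition regular_singular_point :: "diffop \<Rightarrow> sphere_point \<Rightarrow> bool" where
  "regular_singular_point A P \<longleftrightarrow> singular_point A P \<and>
     (\<forall>k\<le>degree (local_op A P).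
        \<not> rat_pole (rat_X ^ (degree (local_op A P) - k) * coeff (local_op A P) k) 0)"

text \<open>\<open>\<Sum>\<^sub>k (w\<^sup>N\<^sup>-\<^sup>k b\<^sub>k)(0) \<rho>(\<rho> - 1)\<dots>(\<rho> - k + 1)\<close> as a polynomial in \<open>\<rho>\<close>. This is meaningful at
  ordinary and at regular singular points.\<close>

definition indicial_poly :: "diffop \<Rightarrow> sphere_point \<Rightarrow> complex poly" where
  "indicial_poly A P = (\<Sum>k\<le>degree (local_op A P).
     Polynomial.smult (rat_eval (rat_X ^ (degree (local_op A P) - k) * coeff (local_op A P) k) 0)
       (\<Prod>j<k. [:- of_nat j, 1:]))"

definition exponents :: "diffop \<Rightarrow> sphere_point \<Rightarrow> complex multiset" where
  "exponents A P = proots (indicial_poly A P)"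


section \<open>Multi-valued analytic functions\<close>

text \<open>
  A multi-valued analytic function on an open set \<open>S\<close> is a holomorphic function on a simply
  connected surface lying over \<open>S\<close>. Such a surface is given here as a simply connected open
  \<open>W \<subseteq> \<complex>\<close> with a locally biholomorphic projection \<open>\<pi> : W \<rightarrow> S\<close>. With \<open>\<pi>\<close> the identity this
  describes single-valued branches on simply connected subsets of \<open>S\<close>. If \<open>S\<close> is the complement
  of a nonempty finite set, then by uniformization the universal covering of \<open>S\<close> also has this
  form, which gives the functions that can be continued analytically along all paths in \<open>S\<close>.
\<close>

definition sheet_over :: "complex set \<Rightarrow> complex set \<Rightarrow> (complex \<Rightarrow> complex) \<Rightarrow> bool" where
  "sheet_over S W \<pi> \<longleftrightarrow> open W \<and> simply_connected W \<and> \<pi> holomorphic_on W \<and>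
     (\<forall>w\<in>W. deriv \<pi> w \<noteq> 0) \<and> \<pi> ` W \<subseteq> S"

text \<open>The derivation \<open>d/dx\<close> on functions on \<open>W\<close>, where \<open>x = \<pi>(w)\<close>.\<close>

definition ddx_on :: "(complex \<Rightarrow> complex) \<Rightarrow> (complex \<Rightarrow> complex) \<Rightarrow> complex \<Rightarrow> complex" where
  "ddx_on \<pi> f = (\<lambda>w. deriv f w / deriv \<pi> w)"

definition dop_apply ::
  "(complex \<Rightarrow> complex) \<Rightarrow> diffop \<Rightarrow> (complex \<Rightarrow> complex) \<Rightarrow> complex \<Rightarrow> complex" where
  "dop_apply \<pi> A u w = (\<Sum>k\<le>degree A. rat_eval (coeff A k) (\<pi> w) * (ddx_on \<pi> ^^ k) u w)"

definition solution_on ::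
  "complex set \<Rightarrow> (complex \<Rightarrow> complex) \<Rightarrow> diffop \<Rightarrow> (complex \<Rightarrow> complex) \<Rightarrow> bool" where
  "solution_on W \<pi> A u \<longleftrightarrow> u holomorphic_on W \<and> (\<forall>w\<in>W. dop_apply \<pi> A u w = 0)"

text \<open>The Wronskian of \<open>u\<^sub>1, \<dots>, u\<^sub>i\<close>; rows and columns of the matrix are numbered from 0.\<close>

definition wronskian ::
  "(complex \<Rightarrow> complex) \<Rightarrow> nat \<Rightarrow> (nat \<Rightarrow> complex \<Rightarrow> complex) \<Rightarrow> complex \<Rightarrow> complex" where
  "wronskian \<pi> i u w =
     Determinant.det (Matrix.mat i i (\<lambda>(a, b). (ddx_on \<pi> ^^ a) (u (Suc b)) w))"

text \<open>\<open>T\<close> is a branch on \<open>W\<close> of \<open>\<Prod>\<^sub>s (x - z\<^sub>s)\<^bsup>e\<^sub>s\<^esup>\<close>; \<open>L s\<close> is the chosen branch of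
  \<open>ln (x - z\<^sub>s)\<close>.\<close>

definition power_product_branch :: "complex set \<Rightarrow> (complex \<Rightarrow> complex) \<Rightarrow> nat \<Rightarrow>
    (nat \<Rightarrow> complex) \<Rightarrow> (nat \<Rightarrow> complex) \<Rightarrow> (complex \<Rightarrow> complex) \<Rightarrow> bool" where
  "power_product_branch W \<pi> n z e T \<longleftrightarrow>
     (\<exists>L. (\<forall>s\<in>{1..n}. L s holomorphic_on W \<and> (\<forall>w\<in>W. exp (L s w) = \<pi> w - z s)) \<and>
          (\<forall>w\<in>W. T w = (\<Prod>s=1..n. exp (e s * L s w))))"


section \<open>Weights of the general linear Lie algebra\<close>

text \<open>An element of \<open>\<hh>\<^sup>*\<close> for \<open>\<gg>\<ll>\<^bsub>r+1\<^esub>\<close> is given by its coordinates in the basis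
  \<open>e\<^sup>*\<^bsub>1,1\<^esub>, \<dots>, e\<^sup>*\<^bsub>r+1,r+1\<^esub>\<close>, that is, by its values \<open>\<lambda> i = \<langle>\<lambda>, e\<^bsub>i,i\<^esub>\<rangle>\<close> for \<open>i \<in> {1..r+1}\<close>; other
  indices are never used.\<close>

type_synonym weight = "nat \<Rightarrow> complex"

definition e_star :: "nat \<Rightarrow> weight" where
  "e_star a = (\<lambda>i. if i = a then 1 else 0)"

definition alpha :: "nat \<Rightarrow> weight" where
  "alpha a = (\<lambda>i. e_star a i - e_star (a + 1) i)"

definition scal :: "nat \<Rightarrow> weight \<Rightarrow> weight \<Rightarrow> complex" where
  "scal r \<mu> \<nu> = (\<Sum>i=1..r+1. \<mu> i * \<nu> i)"

definition Lambda_infty ::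
  "nat \<Rightarrow> nat \<Rightarrow> (nat \<Rightarrow> weight) \<Rightarrow> (nat \<Rightarrow> nat) \<Rightarrow> weight" where
  "Lambda_infty r n \<Lambda> l = (\<lambda>i. (\<Sum>s=1..n. \<Lambda> s i) - (\<Sum>j=1..r. of_nat (l j) * alpha j i))"

definition separating :: "nat \<Rightarrow> nat \<Rightarrow> (nat \<Rightarrow> weight) \<Rightarrow> (nat \<Rightarrow> nat) \<Rightarrow> bool" where
  "separating r n \<Lambda> l \<longleftrightarrow>
     (\<forall>c :: nat \<Rightarrow> int. (\<forall>i\<in>{1..r}. 0 \<le> c i \<and> c i \<le> int (l i)) \<and> (\<Sum>i=1..r. c i) \<noteq> 0 \<longrightarrow>
        (let \<gamma> = (\<lambda>k. \<Sum>i=1..r. of_int (c i) * alpha i k) in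
          scal r (\<lambda>k. 2 * Lambda_infty r n \<Lambda> l k + \<gamma> k) \<gamma> + 2 * of_int (\<Sum>i=1..r. c i) \<noteq> 0))"


section \<open>Critical points of the master function and the fundamental operator\<close>

text \<open>The convention \<open>l\<^sub>0 = l\<^bsub>r+1\<^esub> = 0\<close>.\<close>

definition ext_l :: "nat \<Rightarrow> (nat \<Rightarrow> nat) \<Rightarrow> nat \<Rightarrow> nat" where
  "ext_l r l i = (if i \<in> {1..r} then l i else 0)"

text \<open>\<open>t i j\<close> is the variable \<open>t\<^sub>j\<^bsup>(i)\<^esup>\<close>. The first three conjuncts say that the fractions in the
  critical point equations are well defined; only terms with \<open>(\<Lambda>\<^sub>s, \<alpha>\<^sub>i) \<noteq> 0\<close> occur in the first
  sum, so \<open>t\<^sub>j\<^bsup>(i)\<^esup> = z\<^sub>s\<close> is allowed when \<open>(\<Lambda>\<^sub>s, \<alpha>\<^sub>i) = 0\<close>.\<close>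

definition critical_point :: "nat \<Rightarrow> nat \<Rightarrow> (nat \<Rightarrow> complex) \<Rightarrow> (nat \<Rightarrow> weight) \<Rightarrow>
    (nat \<Rightarrow> nat) \<Rightarrow> (nat \<Rightarrow> nat \<Rightarrow> complex) \<Rightarrow> bool" where
  "critical_point r n z \<Lambda> l t \<longleftrightarrow>
     (\<forall>i\<in>{1..r}. \<forall>j\<in>{1..l i}. \<forall>s\<in>{1..n}. scal r (\<Lambda> s) (alpha i) \<noteq> 0 \<longrightarrow> t i j \<noteq> z s) \<and>
     (\<forall>i\<in>{1..r}. \<forall>j\<in>{1..l i}. \<forall>s\<in>{1..l i}. s \<noteq> j \<longrightarrow> t i j \<noteq> t i s) \<and>
     (\<forall>i\<in>{1..<r}. \<forall>j\<in>{1..l i}. \<forall>k\<in>{1..l (i + 1)}. t i j \<noteq> t (i + 1) k) \<and>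
     (\<forall>i\<in>{1..r}. \<forall>j\<in>{1..l i}.
        (\<Sum>s\<in>{s\<in>{1..n}. scal r (\<Lambda> s) (alpha i) \<noteq> 0}.
            scal r (\<Lambda> s) (alpha i) / (t i j - z s))
        - (\<Sum>s\<in>{1..l i} - {j}. 2 / (t i j - t i s))
        + (\<Sum>s=1..ext_l r l (i - 1). 1 / (t i j - t (i - 1) s))
        + (\<Sum>s=1..ext_l r l (i + 1). 1 / (t i j - t (i + 1) s)) = 0)"

text \<open>In particular \<open>y\<^sub>0 = y\<^bsub>r+1\<^esub> = 1\<close>.\<close>

definition y_poly :: "nat \<Rightarrow> (nat \<Rightarrow> nat) \<Rightarrow> (nat \<Rightarrow> nat \<Rightarrow> complex) \<Rightarrow> nat \<Rightarrow> complex poly" where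
  "y_poly r l t i = (\<Prod>j=1..ext_l r l i. [:- t i j, 1:])"

text \<open>\<open>ln'(T\<^sub>i)\<close> for the multi-valued function \<open>T\<^sub>i = \<Prod>\<^sub>s (x - z\<^sub>s)\<^bsup>-m\<^sub>s\<^sub>,\<^sub>i\<^esup>\<close>, with \<open>m\<^sub>s\<^sub>,\<^sub>i = \<Lambda> s i\<close>.\<close>

definition lnderiv_T :: "nat \<Rightarrow> (nat \<Rightarrow> complex) \<Rightarrow> (nat \<Rightarrow> weight) \<Rightarrow> nat \<Rightarrow> ratfun" where
  "lnderiv_T n z \<Lambda> i = (\<Sum>s=1..n. rat_const (- \<Lambda> s i) / to_fract [:- z s, 1:])"

text \<open>\<open>d/dx - ln'(y\<^sub>i T\<^sub>i / y\<^bsub>i-1\<^esub>)\<close>\<close>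

definition fund_factor :: "nat \<Rightarrow> nat \<Rightarrow> (nat \<Rightarrow> complex) \<Rightarrow> (nat \<Rightarrow> weight) \<Rightarrow>
    (nat \<Rightarrow> nat) \<Rightarrow> (nat \<Rightarrow> nat \<Rightarrow> complex) \<Rightarrow> nat \<Rightarrow> diffop" where
  "fund_factor r n z \<Lambda> l t i =
     [: - (lnderiv (to_fract (y_poly r l t i) / to_fract (y_poly r l t (i - 1)))
           + lnderiv_T n z \<Lambda> i), 1 :]"

primrec fund_partial :: "nat \<Rightarrow> nat \<Rightarrow> (nat \<Rightarrow> complex) \<Rightarrow> (nat \<Rightarrow> weight) \<Rightarrow>
    (nat \<Rightarrow> nat) \<Rightarrow> (nat \<Rightarrow> nat \<Rightarrow> complex) \<Rightarrow> nat \<Rightarrow> diffop" where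
  "fund_partial r n z \<Lambda> l t 0 = 1"
| "fund_partial r n z \<Lambda> l t (Suc i) =
     dop_comp (fund_factor r n z \<Lambda> l t (Suc i)) (fund_partial r n z \<Lambda> l t i)"

definition fundamental_operator :: "nat \<Rightarrow> nat \<Rightarrow> (nat \<Rightarrow> complex) \<Rightarrow> (nat \<Rightarrow> weight) \<Rightarrow>
    (nat \<Rightarrow> nat) \<Rightarrow> (nat \<Rightarrow> nat \<Rightarrow> complex) \<Rightarrow> diffop" where
  "fundamental_operator r n z \<Lambda> l t = fund_partial r n z \<Lambda> l t (r + 1)"

end

theory Submission
  imports Defs
begin

text \<open>
  Put \<open>f\<^sub>i = y\<^sub>i T\<^sub>i / y\<^sub>i\<^sub>-\<^sub>1\<close>, so that the operator is the product of the factors \<open>d/dx - g\<^sub>i\<close> with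
  \<open>g\<^sub>i = ln'(f\<^sub>i)\<close>. Each \<open>g\<^sub>i\<close> is a sum of fractions \<open>c/(x - a)\<close>, with \<open>a\<close> one of the \<open>z\<^sub>s\<close> or a root of
  \<open>y\<^sub>i\<close> or \<open>y\<^sub>i\<^sub>-\<^sub>1\<close>.

  Exponents. In a local parameter \<open>w\<close> at any point of the sphere the operator is, up to a factor on
  the left, again a product of first order factors whose poles at \<open>w = 0\<close> are at most simple
  (\<open>local_op_chain\<close>). For such a product the indicial polynomial can be read off from the residues:
  the \<open>i\<close>-th exponent is the \<open>i\<close>-th residue plus \<open>i - 1\<close> (\<open>exponents_factor_chain\<close>). At \<open>z\<^sub>s\<close> a root of
  \<open>y\<^sub>i\<close> is possible only if \<open>m\<^sub>s\<^sub>,\<^sub>i = m\<^sub>s\<^sub>,\<^sub>i\<^sub>+\<^sub>1\<close>, and it then interchanges two consecutive exponents.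

  Ordinary points. At a root \<open>p\<close> of \<open>y\<^sub>i\<close> that is not one of the \<open>z\<^sub>s\<close>, the functions \<open>g\<^sub>i\<close> and \<open>g\<^sub>i\<^sub>+\<^sub>1\<close> have
  the polar parts \<open>1/(x - p)\<close> and \<open>- 1/(x - p)\<close>. The product of the two first order factors has no pole at \<open>p\<close> exactly
  if the regular parts of \<open>g\<^sub>i\<close> and \<open>g\<^sub>i\<^sub>+\<^sub>1\<close> agree at \<open>p\<close>, which is the critical point equation
  (\<open>bethe_equation\<close>, \<open>regular_op_cancelling_pair\<close>).

  Solutions. A solution \<open>u\<^sub>i\<close> that the first \<open>i - 1\<close> factors turn into \<open>f\<^sub>i\<close> is annihilated by the \<open>i\<close>-th
  factor, and row operations on the Wronskian matrix of such \<open>u\<^sub>1, \<dots>, u\<^sub>i\<close> produce a triangular matrix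
  with diagonal \<open>f\<^sub>1, \<dots>, f\<^sub>i\<close>. Hence the Wronskian is \<open>f\<^sub>1 \<cdots> f\<^sub>i = y\<^sub>i T\<^sub>i \<cdots> T\<^sub>1\<close>. Formally \<open>u\<^sub>i = f\<^sub>1 q\<^sub>1\<close>, where
  \<open>q\<^sub>i = 1\<close> and \<open>q\<^sub>k\<close> is an antiderivative of \<open>q\<^sub>k\<^sub>+\<^sub>1 f\<^sub>k\<^sub>+\<^sub>1 / f\<^sub>k\<close>. To see that all \<open>q\<^sub>k\<close> exist and that
  \<open>u\<^sub>i\<close> has no poles, write \<open>q\<^sub>k = N\<^sub>k / y\<^sub>k\<close>; the condition becomes
  \<open>N\<^sub>k' y\<^sub>k - N\<^sub>k y\<^sub>k' = N\<^sub>k\<^sub>+\<^sub>1 y\<^sub>k\<^sub>-\<^sub>1 T\<^sub>k\<^sub>+\<^sub>1 / T\<^sub>k\<close>. On a simply connected surface this has a holomorphic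
  solution \<open>N\<^sub>k\<close> as soon as \<open>1/y\<^sub>k\<^sup>2\<close> times the right-hand side has no residues
  (\<open>wronskian_equation_solvable\<close>), and the vanishing of the residues is once more the critical point
  equation (\<open>numerators_exist\<close>). Then \<open>u\<^sub>i = T\<^sub>1 N\<^sub>1\<close>.
\<close>

section \<open>Rational functions regular at a point\<close>

text \<open>The denominator in lowest terms has no zero where some other denominator has none, because a
  common zero of numerator and denominator contradicts coprimality.\<close>

lemma rat_regular_fraction:
  assumes "poly b p \<noteq> 0" and q: "q = to_fract a / to_fract b"
  shows "\<not> rat_pole q p" and "rat_eval q p = poly a p / poly b p"
proof -
  obtain n d where nd: "quot_of_fract q = (n, d)" by fastforce
  have "d \<noteq> 0" using snd_quot_of_fract_nonzero[of q] nd by simp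
  have "q = to_fract n / to_fract d"
    using Fract_quot_of_fract[of q] nd by (simp add: Fract_conv_to_fract)
  moreover have "b \<noteq> 0" using assms by auto
  ultimately have "to_fract (n * b) = to_fract (a * d)"
    using q \<open>d \<noteq> 0\<close> by (simp add: field_simps)
  then have "n * b = a * d" by (simp only: to_fract_eq_iff)
  then have e: "poly n p * poly b p = poly a p * poly d p"
    by (metis poly_mult)
  have "coprime n d" using coprime_quot_of_fract[of q] nd by simp
  have "poly d p \<noteq> 0"
  proof
    assume d: "poly d p = 0"
    then have "poly n p = 0" using e assms by simp
    then have "[:-p, 1:] dvd n" "[:-p, 1:] dvd d" using d by (simp_all add: poly_eq_0_iff_dvd)
    then have "is_unit [:-p, 1:]" using \<open>coprime n d\<close> coprime_common_divisor by blast
    then show False by (simp add: is_unit_iff_degree)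
  qed
  then show "\<not> rat_pole q p" "rat_eval q p = poly a p / poly b p"
    using nd e assms by (auto simp: rat_pole_def rat_eval_def field_simps)
qed

lemma rat_regularE:
  assumes "\<not> rat_pole q p"
  obtains a b where "poly b p \<noteq> 0" and "q = to_fract a / to_fract b"
  using assms Fract_quot_of_fract[of q]
  unfolding rat_pole_def Fract_conv_to_fract by metis

lemma fractE:
  obtains a b :: "complex poly" where "b \<noteq> 0" and "q = to_fract a / to_fract b"
  using Fract_quot_of_fract[of q] snd_quot_of_fract_nonzero[of q]
  unfolding Fract_conv_to_fract by metis

lemma rat_regular_to_fract [simp]: "\<not> rat_pole (to_fract a) p" "rat_eval (to_fract a) p = poly a p"
  using rat_regular_fraction[of 1 p "to_fract a" a] by simp_all

lemma rat_regular_0 [simp]: "\<not> rat_pole 0 p" "rat_eval 0 p = 0"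
  using rat_regular_to_fract[of 0 p] by simp_all

lemma rat_regular_1 [simp]: "\<not> rat_pole 1 p" "rat_eval 1 p = 1"
  using rat_regular_to_fract[of 1 p] by simp_all

lemma rat_regular_of_nat [simp]: "\<not> rat_pole (of_nat k) p" "rat_eval (of_nat k) p = of_nat k"
proof -
  have "(of_nat k :: ratfun) = to_fract (of_nat k)" by (induction k) auto
  then show "\<not> rat_pole (of_nat k) p" "rat_eval (of_nat k) p = of_nat k" by simp_all
qed

lemma rat_regular_add:
  assumes "\<not> rat_pole q p" "\<not> rat_pole q' p"
  shows "\<not> rat_pole (q + q') p \<and> rat_eval (q + q') p = rat_eval q p + rat_eval q' p"
proof -
  obtain a b a' b' where *: "poly b p \<noteq> 0" "q = to_fract a / to_fract b"
    "poly b' p \<noteq> 0" "q' = to_fract a' / to_fract b'"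
    using assms by (metis rat_regularE)
  moreover from this have "b \<noteq> 0" "b' \<noteq> 0" by auto
  ultimately have "q + q' = to_fract (a * b' + a' * b) / to_fract (b * b')"
    by (simp add: add_frac_eq)
  then show ?thesis
    using rat_regular_fraction[of "b * b'" p "q + q'" "a * b' + a' * b"] rat_regular_fraction[of b p q a]
      rat_regular_fraction[of b' p q' a'] * by (simp add: add_frac_eq)
qed

lemma rat_regular_mult:
  assumes "\<not> rat_pole q p" "\<not> rat_pole q' p"
  shows "\<not> rat_pole (q * q') p \<and> rat_eval (q * q') p = rat_eval q p * rat_eval q' p"
proof -
  obtain a b a' b' where *: "poly b p \<noteq> 0" "q = to_fract a / to_fract b"
    "poly b' p \<noteq> 0" "q' = to_fract a' / to_fract b'"
    using assms by (metis rat_regularE)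
  then have "q * q' = to_fract (a * a') / to_fract (b * b')" by simp
  then show ?thesis
    using rat_regular_fraction[of "b * b'" p "q * q'" "a * a'"] rat_regular_fraction[of b p q a]
      rat_regular_fraction[of b' p q' a'] * by simp
qed

lemmas rat_pole_add = rat_regular_add[THEN conjunct1]
lemmas rat_eval_add = rat_regular_add[THEN conjunct2]
lemmas rat_pole_mult = rat_regular_mult[THEN conjunct1]
lemmas rat_eval_mult = rat_regular_mult[THEN conjunct2]

lemma rat_regular_uminus:
  assumes "\<not> rat_pole q p"
  shows "\<not> rat_pole (- q) p \<and> rat_eval (- q) p = - rat_eval q p"
  using rat_regular_mult[of "to_fract (- 1)" p q] rat_regular_to_fract[of "- 1" p] assms by simp

lemmas rat_pole_uminus = rat_regular_uminus[THEN conjunct1]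

lemma rat_pole_diff: "\<not> rat_pole q p \<Longrightarrow> \<not> rat_pole q' p \<Longrightarrow> \<not> rat_pole (q - q') p"
  using rat_pole_add[of q p "- q'"] rat_pole_uminus[of q' p] by simp

lemma rat_eval_diff:
  "\<not> rat_pole q p \<Longrightarrow> \<not> rat_pole q' p \<Longrightarrow> rat_eval (q - q') p = rat_eval q p - rat_eval q' p"
  using rat_eval_add[of q p "- q'"] rat_regular_uminus[of q' p] by simp

lemma rat_regular_sum:
  assumes "\<And>i. i \<in> A \<Longrightarrow> \<not> rat_pole (f i) p"
  shows "\<not> rat_pole (\<Sum>i\<in>A. f i) p \<and> rat_eval (\<Sum>i\<in>A. f i) p = (\<Sum>i\<in>A. rat_eval (f i) p)"
  using assms by (induction A rule: infinite_finite_induct) (auto simp: rat_regular_add)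

lemmas rat_pole_sum = rat_regular_sum[THEN conjunct1]

lemma rat_pole_power: "\<not> rat_pole q p \<Longrightarrow> \<not> rat_pole (q ^ k) p"
  by (induction k) (simp_all add: rat_pole_mult)

lemmas rat_regular_intros =
  rat_pole_add rat_pole_mult rat_pole_uminus rat_pole_diff rat_pole_sum rat_pole_power

lemma rat_regular_divide_uniformiser:
  assumes "\<not> rat_pole q p" "rat_eval q p = 0"
  shows "\<not> rat_pole (q / to_fract [:- p, 1:]) p"
proof -
  obtain a b where ab: "poly b p \<noteq> 0" "q = to_fract a / to_fract b"
    using assms(1) by (rule rat_regularE)
  then have "poly a p = 0" using assms(2) rat_regular_fraction(2)[of b p q a] by simp
  then obtain c where "a = [:- p, 1:] * c" by (auto simp: poly_eq_0_iff_dvd elim: dvdE)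
  then have "to_fract a = to_fract [:- p, 1:] * to_fract c" by (simp only: to_fract_mult)
  then have "q / to_fract [:- p, 1:] = to_fract c / to_fract b" using ab by simp
  then show ?thesis using ab rat_regular_fraction(1) by blast
qed

section \<open>The derivation of the field of rational functions\<close>

lemma rat_deriv_fraction:
  assumes "b \<noteq> 0"
  shows "rat_deriv (to_fract a / to_fract b) =
    to_fract (pderiv a * b - a * pderiv b) / to_fract (b ^ 2)"
proof -
  define q where "q = to_fract a / to_fract b"
  obtain n d where nd: "quot_of_fract q = (n, d)" by fastforce
  have "d \<noteq> 0" using snd_quot_of_fract_nonzero[of q] nd by simp
  have "q = to_fract n / to_fract d"
    using Fract_quot_of_fract[of q] nd by (simp add: Fract_conv_to_fract)
  then have "to_fract (n * b) = to_fract (a * d)"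
    using q_def \<open>d \<noteq> 0\<close> assms by (simp add: field_simps)
  then have e: "n * b = a * d" by (simp only: to_fract_eq_iff)
  then have "pderiv (n * b) = pderiv (a * d)" by simp
  then have e': "pderiv n * b + n * pderiv b = pderiv a * d + a * pderiv d"
    by (simp add: pderiv_mult algebra_simps)
  have "(pderiv n * d - n * pderiv d) * b\<^sup>2 = (pderiv a * b - a * pderiv b) * d\<^sup>2"
  proof -
    have "(pderiv n * d - n * pderiv d) * b\<^sup>2 - (pderiv a * b - a * pderiv b) * d\<^sup>2 =
        d * b * ((pderiv n * b + n * pderiv b) - (pderiv a * d + a * pderiv d))
        - (pderiv d * b + pderiv b * d) * (n * b - a * d)"
      by (simp add: algebra_simps power2_eq_square)
    also have "\<dots> = 0" by (simp only: e e') simp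
    finally show ?thesis by simp
  qed
  then have "to_fract (pderiv n * d - n * pderiv d) * to_fract (b\<^sup>2) =
      to_fract (pderiv a * b - a * pderiv b) * to_fract (d\<^sup>2)"
    by (metis to_fract_mult)
  moreover have "to_fract (b\<^sup>2) \<noteq> 0" "to_fract (d\<^sup>2) \<noteq> 0"
    using assms \<open>d \<noteq> 0\<close> by (simp_all only: to_fract_eq_0_iff) auto
  moreover have "rat_deriv q = to_fract (pderiv n * d - n * pderiv d) / to_fract (d\<^sup>2)"
    by (simp add: rat_deriv_def nd)
  ultimately show ?thesis by (simp add: q_def frac_eq_eq del: to_fract_diff to_fract_mult)
qed

lemma rat_deriv_to_fract [simp]: "rat_deriv (to_fract a) = to_fract (pderiv a)"
  using rat_deriv_fraction[of 1 a] by simp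

lemma rat_deriv_0 [simp]: "rat_deriv 0 = 0" and rat_deriv_1 [simp]: "rat_deriv 1 = 0"
  using rat_deriv_to_fract[of 0] rat_deriv_to_fract[of 1] by (simp_all del: rat_deriv_to_fract)

lemma to_fract_power [simp]: "to_fract (a ^ k) = to_fract a ^ k"
  by (induction k) simp_all

lemma rat_deriv_add: "rat_deriv (q + q') = rat_deriv q + rat_deriv q'"
proof -
  obtain a b a' b' where *: "b \<noteq> 0" "q = to_fract a / to_fract b"
    "b' \<noteq> 0" "q' = to_fract a' / to_fract b'"
    by (metis fractE)
  then have s: "q + q' = to_fract (a * b' + a' * b) / to_fract (b * b')"
    by (auto simp: add_frac_eq)
  have "b * b' \<noteq> 0" using * by simp
  note d = rat_deriv_fraction[OF \<open>b \<noteq> 0\<close>, of a] rat_deriv_fraction[OF \<open>b' \<noteq> 0\<close>, of a']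
    rat_deriv_fraction[OF \<open>b * b' \<noteq> 0\<close>]
  show ?thesis unfolding s d unfolding * d using *(1,3)
    by (simp add: pderiv_add pderiv_mult field_simps power2_eq_square)
qed

lemma rat_deriv_mult: "rat_deriv (q * q') = rat_deriv q * q' + q * rat_deriv q'"
proof -
  obtain a b a' b' where *: "b \<noteq> 0" "q = to_fract a / to_fract b"
    "b' \<noteq> 0" "q' = to_fract a' / to_fract b'"
    by (metis fractE)
  then have s: "q * q' = to_fract (a * a') / to_fract (b * b')" by simp
  have "b * b' \<noteq> 0" using * by simp
  note d = rat_deriv_fraction[OF \<open>b \<noteq> 0\<close>, of a] rat_deriv_fraction[OF \<open>b' \<noteq> 0\<close>, of a']
    rat_deriv_fraction[OF \<open>b * b' \<noteq> 0\<close>]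
  show ?thesis unfolding s d unfolding * d using *(1,3)
    by (simp add: pderiv_add pderiv_mult field_simps power2_eq_square)
qed

lemma rat_deriv_uminus: "rat_deriv (- q) = - rat_deriv q"
  using rat_deriv_mult[of "to_fract (-1)" q] rat_deriv_to_fract[of "-1"] by (simp add: pderiv_minus)

lemma rat_deriv_diff: "rat_deriv (q - q') = rat_deriv q - rat_deriv q'"
  using rat_deriv_add[of q "- q'"] by (simp add: rat_deriv_uminus)

lemma rat_deriv_inverse: "q \<noteq> 0 \<Longrightarrow> rat_deriv (1 / q) = - rat_deriv q / q\<^sup>2"
  using rat_deriv_mult[of q "1 / q"] by (simp add: field_simps power2_eq_square eq_neg_iff_add_eq_0 add.commute)

lemma rat_deriv_divide: "q' \<noteq> 0 \<Longrightarrow> rat_deriv (q / q') = rat_deriv q / q' - q * rat_deriv q' / q'\<^sup>2"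
  using rat_deriv_mult[of q "1 / q'"] rat_deriv_inverse[of q'] by simp

lemma rat_deriv_power: "rat_deriv (q ^ k) = of_nat k * q ^ (k - 1) * rat_deriv q"
proof (induction k)
  case (Suc k)
  then show ?case by (cases k) (simp_all add: rat_deriv_mult algebra_simps)
qed simp

lemma rat_deriv_regular:
  assumes "\<not> rat_pole q p"
  shows "\<not> rat_pole (rat_deriv q) p"
proof -
  obtain a b where *: "poly b p \<noteq> 0" "q = to_fract a / to_fract b"
    using assms by (rule rat_regularE)
  then have "b \<noteq> 0" "poly (b\<^sup>2) p \<noteq> 0" by auto
  then show ?thesis unfolding *(2) rat_deriv_fraction[OF \<open>b \<noteq> 0\<close>]
    using rat_regular_fraction(1) by blast
qed

lemma rat_const_1 [simp]: "rat_const 1 = 1"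
  by (simp flip: one_pCons)

lemma lnderiv_mult:
  "f \<noteq> 0 \<Longrightarrow> g \<noteq> 0 \<Longrightarrow> lnderiv (f * g) = lnderiv f + lnderiv g"
  by (simp add: lnderiv_def rat_deriv_mult field_simps)

lemma lnderiv_divide:
  "f \<noteq> 0 \<Longrightarrow> g \<noteq> 0 \<Longrightarrow> lnderiv (f / g) = lnderiv f - lnderiv g"
  using lnderiv_mult[of "f / g" g] by simp

lemma to_fract_linear_nonzero [simp]: "to_fract [:c, 1:] \<noteq> 0" for c :: complex
  by simp

lemma lnderiv_prod_linear:
  "finite J \<Longrightarrow> lnderiv (to_fract (\<Prod>j\<in>J. [:- c j, 1:])) = (\<Sum>j\<in>J. 1 / to_fract [:- c j, 1:])"
proof (induction J rule: finite_induct)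
  case empty
  then show ?case by (simp add: lnderiv_def)
next
  case (insert j J)
  have "to_fract (\<Prod>j\<in>J. [:- c j, 1:]) \<noteq> 0" using insert by simp
  then have "lnderiv (to_fract [:- c j, 1:] * to_fract (\<Prod>j\<in>J. [:- c j, 1:])) =
      lnderiv (to_fract [:- c j, 1:]) + (\<Sum>j\<in>J. 1 / to_fract [:- c j, 1:])"
    using insert by (simp only: lnderiv_mult to_fract_linear_nonzero not_False_eq_True)
  moreover have "lnderiv (to_fract [:- c j, 1:]) = 1 / to_fract [:- c j, 1:]"
    by (simp add: lnderiv_def pderiv_pCons)
  ultimately show ?case using insert by (simp only: prod.insert[OF insert(1,2)] sum.insert[OF insert(1,2)] to_fract_mult)
qed

section \<open>Substitution into rational functions\<close>

abbreviation poly_at :: "ratfun \<Rightarrow> complex poly \<Rightarrow> ratfun" where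
  "poly_at \<phi> a \<equiv> poly (map_poly rat_const a) \<phi>"

lemma poly_at_pCons: "poly_at \<phi> (pCons c a) = rat_const c + \<phi> * poly_at \<phi> a"
  by (simp add: map_poly_pCons)

lemma poly_at_add: "poly_at \<phi> (a + b) = poly_at \<phi> a + poly_at \<phi> b"
proof (induction a b rule: poly_induct2)
  case (pCons a p b q)
  have "rat_const (a + b) = rat_const a + rat_const b" by (simp flip: to_fract_add)
  then show ?case by (simp add: poly_at_pCons pCons algebra_simps)
qed simp

lemma poly_at_smult: "poly_at \<phi> (Polynomial.smult c a) = rat_const c * poly_at \<phi> a"
proof (induction a)
  case (pCons a p)
  have "rat_const (c * a) = rat_const c * rat_const a" by (simp flip: to_fract_mult)
  then show ?case by (simp add: poly_at_pCons pCons algebra_simps)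
qed simp

lemma poly_at_mult: "poly_at \<phi> (a * b) = poly_at \<phi> a * poly_at \<phi> b"
proof (induction a)
  case (pCons c p)
  then show ?case
    by (simp add: poly_at_pCons poly_at_add poly_at_smult mult_pCons_left algebra_simps)
qed simp

lemma poly_at_uminus: "poly_at \<phi> (- a) = - poly_at \<phi> a"
  using poly_at_add[where \<phi> = \<phi> and a = a and b="- a"] by (simp add: eq_neg_iff_add_eq_0 add.commute)

lemma poly_at_diff: "poly_at \<phi> (a - b) = poly_at \<phi> a - poly_at \<phi> b"
  using poly_at_add[where \<phi> = \<phi> and a = a and b="- b"] by (simp add: poly_at_uminus)

lemma poly_at_1 [simp]: "poly_at \<phi> 1 = 1"
  by (simp add: one_pCons poly_at_pCons)

text \<open>A nonconstant \<open>\<phi>\<close> is transcendental over \<open>\<complex>\<close>: a nonzero polynomial splits into linear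
  factors, none of which vanishes at \<open>\<phi>\<close>.\<close>

lemma poly_at_nonzero:
  assumes "\<phi> \<notin> range rat_const" and "b \<noteq> 0"
  shows "poly_at \<phi> b \<noteq> 0"
  using assms(2)
proof (induction "degree b" arbitrary: b)
  case 0
  then obtain c where "b = [:c:]" by (metis degree_eq_zeroE)
  with 0 show ?case by (simp add: poly_at_pCons)
next
  case (Suc d)
  then obtain x where "poly b x = 0"
    using fundamental_theorem_of_algebra[of b] by (auto simp: constant_degree)
  then obtain q where q: "b = [:- x, 1:] * q" by (auto simp: poly_eq_0_iff_dvd elim: dvdE)
  then have "q \<noteq> 0" using Suc by auto
  then have "degree b = Suc (degree q)" unfolding q by (subst degree_mult_eq) auto
  then have "poly_at \<phi> q \<noteq> 0" using Suc \<open>q \<noteq> 0\<close> by simp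
  moreover have "poly_at \<phi> [:- x, 1:] = \<phi> - rat_const x"
    by (simp add: poly_at_pCons one_pCons[symmetric] flip: to_fract_uminus)
  moreover have "\<phi> \<noteq> rat_const x" using assms by auto
  ultimately show ?case by (simp only: q poly_at_mult) simp
qed

lemma rat_comp_fraction:
  assumes "\<phi> \<notin> range rat_const" and "b \<noteq> 0"
  shows "rat_comp (to_fract a / to_fract b) \<phi> = poly_at \<phi> a / poly_at \<phi> b"
proof -
  define q where "q = to_fract a / to_fract b"
  obtain n d where nd: "quot_of_fract q = (n, d)" by fastforce
  have "d \<noteq> 0" using snd_quot_of_fract_nonzero[of q] nd by simp
  have "q = to_fract n / to_fract d"
    using Fract_quot_of_fract[of q] nd by (simp add: Fract_conv_to_fract)
  then have "to_fract (n * b) = to_fract (a * d)"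
    using q_def \<open>d \<noteq> 0\<close> assms by (simp add: field_simps)
  then have "n * b = a * d" by (simp only: to_fract_eq_iff)
  then have "poly_at \<phi> n * poly_at \<phi> b = poly_at \<phi> a * poly_at \<phi> d"
    by (metis poly_at_mult)
  then show ?thesis
    using poly_at_nonzero[OF assms(1)] assms(2) \<open>d \<noteq> 0\<close> nd
    by (simp add: rat_comp_def q_def[symmetric] field_simps)
qed

lemma rat_comp_to_fract: "rat_comp (to_fract a) \<phi> = poly_at \<phi> a"
  by (simp add: rat_comp_def)

lemma rat_comp_0 [simp]: "rat_comp 0 \<phi> = 0" and rat_comp_1 [simp]: "rat_comp 1 \<phi> = 1"
  using rat_comp_to_fract[of 0 \<phi>] rat_comp_to_fract[of 1 \<phi>] by simp_all

lemma rat_comp_linear: "rat_comp (to_fract [:- c, 1:]) \<phi> = \<phi> - rat_const c"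
  by (simp add: rat_comp_to_fract poly_at_pCons one_pCons[symmetric] flip: to_fract_uminus)

context
  fixes \<phi> :: ratfun
  assumes nonconst: "\<phi> \<notin> range rat_const"
begin

lemma rat_comp_add: "rat_comp (q + q') \<phi> = rat_comp q \<phi> + rat_comp q' \<phi>"
proof -
  obtain a b a' b' where *: "b \<noteq> 0" "q = to_fract a / to_fract b"
    "b' \<noteq> 0" "q' = to_fract a' / to_fract b'"
    by (metis fractE)
  then have s: "q + q' = to_fract (a * b' + a' * b) / to_fract (b * b')"
    by (auto simp: add_frac_eq)
  show ?thesis unfolding s unfolding * using * poly_at_nonzero[OF nonconst]
    by (subst (1 2 3) rat_comp_fraction[OF nonconst])
       (auto simp: poly_at_mult poly_at_add add_frac_eq)
qed

lemma rat_comp_mult: "rat_comp (q * q') \<phi> = rat_comp q \<phi> * rat_comp q' \<phi>"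
proof -
  obtain a b a' b' where *: "b \<noteq> 0" "q = to_fract a / to_fract b"
    "b' \<noteq> 0" "q' = to_fract a' / to_fract b'"
    by (metis fractE)
  then have s: "q * q' = to_fract (a * a') / to_fract (b * b')" by simp
  show ?thesis unfolding s unfolding * using * poly_at_nonzero[OF nonconst]
    by (subst (1 2 3) rat_comp_fraction[OF nonconst]) (auto simp: poly_at_mult)
qed

lemma rat_comp_uminus: "rat_comp (- q) \<phi> = - rat_comp q \<phi>"
  using rat_comp_add[of q "- q"] by (simp add: eq_neg_iff_add_eq_0 add.commute)

lemma rat_comp_diff: "rat_comp (q - q') \<phi> = rat_comp q \<phi> - rat_comp q' \<phi>"
  using rat_comp_add[of q "- q'"] by (simp add: rat_comp_uminus)

lemma rat_comp_sum: "rat_comp (\<Sum>i\<in>A. f i) \<phi> = (\<Sum>i\<in>A. rat_comp (f i) \<phi>)"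
  by (induction A rule: infinite_finite_induct) (simp_all add: rat_comp_add)

lemma rat_comp_divide: "q' \<noteq> 0 \<Longrightarrow> rat_comp (q / q') \<phi> = rat_comp q \<phi> / rat_comp q' \<phi>"
proof -
  assume "q' \<noteq> 0"
  then have "rat_comp q \<phi> = rat_comp (q / q') \<phi> * rat_comp q' \<phi>"
    by (simp flip: rat_comp_mult)
  moreover have "rat_comp (q' * (1 / q')) \<phi> = 1" using \<open>q' \<noteq> 0\<close> by simp
  then have "rat_comp q' \<phi> \<noteq> 0" unfolding rat_comp_mult by auto
  ultimately show ?thesis by simp
qed

lemma rat_deriv_poly_at: "rat_deriv (poly_at \<phi> a) = poly_at \<phi> (pderiv a) * rat_deriv \<phi>"
proof (induction a)
  case (pCons c a)
  then show ?case
    by (simp add: poly_at_pCons poly_at_add pderiv_pCons rat_deriv_add rat_deriv_mult algebra_simps)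
qed simp

lemma rat_deriv_rat_comp: "rat_deriv (rat_comp q \<phi>) = rat_comp (rat_deriv q) \<phi> * rat_deriv \<phi>"
proof -
  obtain a b where *: "b \<noteq> 0" "q = to_fract a / to_fract b" by (metis fractE)
  have n: "poly_at \<phi> b \<noteq> 0" using * poly_at_nonzero[OF nonconst] by simp
  have "b\<^sup>2 \<noteq> 0" using * by simp
  have "rat_comp (rat_deriv q) \<phi> = 
      (poly_at \<phi> (pderiv a) * poly_at \<phi> b - poly_at \<phi> a * poly_at \<phi> (pderiv b)) / (poly_at \<phi> b)\<^sup>2"
    unfolding *(2) rat_deriv_fraction[OF \<open>b \<noteq> 0\<close>] rat_comp_fraction[OF nonconst \<open>b\<^sup>2 \<noteq> 0\<close>]
    by (simp add: poly_at_diff poly_at_mult power2_eq_square)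
  moreover have "rat_deriv (rat_comp q \<phi>) = rat_deriv (poly_at \<phi> a) / poly_at \<phi> b
      - poly_at \<phi> a * rat_deriv (poly_at \<phi> b) / (poly_at \<phi> b)\<^sup>2"
    unfolding *(2) rat_comp_fraction[OF nonconst *(1)] using n by (rule rat_deriv_divide)
  ultimately show ?thesis
    using n by (simp add: rat_deriv_poly_at diff_divide_distrib left_diff_distrib power2_eq_square)
qed

end

section \<open>Products of first order operators\<close>

lemma smult_sum_right:
  "Polynomial.smult q (\<Sum>i\<in>I. f i) = (\<Sum>i\<in>I. Polynomial.smult q (f i))"
  by (induction I rule: infinite_finite_induct) (simp_all add: smult_add_right)

text \<open>Written out, \<open>(d/dx - g\<^sub>N) \<circ> \<dots> \<circ> (d/dx - g\<^sub>1)\<close>. A change of variable preserves this form up to a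
  factor on the left.\<close>

primrec factor_chain :: "(nat \<Rightarrow> ratfun) \<Rightarrow> nat \<Rightarrow> diffop" where
  "factor_chain g 0 = 1"
| "factor_chain g (Suc N) =
     ddx_comp (factor_chain g N) - Polynomial.smult (g (Suc N)) (factor_chain g N)"

lemma coeff_ddx_comp:
  "coeff (ddx_comp A) k = (case k of 0 \<Rightarrow> 0 | Suc j \<Rightarrow> coeff A j) + rat_deriv (coeff A k)"
  by (simp add: ddx_comp_def coeff_map_poly coeff_pCons)

lemma degree_ddx_comp: "degree (ddx_comp A) \<le> Suc (degree A)"
  by (rule degree_le) (auto simp: coeff_ddx_comp coeff_eq_0 split: nat.split)

lemma ddx_comp_add: "ddx_comp (A + B) = ddx_comp A + ddx_comp B"
  by (rule poly_eqI) (simp add: coeff_ddx_comp rat_deriv_add split: nat.split)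

lemma ddx_comp_smult:
  "ddx_comp (Polynomial.smult q A) = Polynomial.smult q (ddx_comp A) + Polynomial.smult (rat_deriv q) A"
  by (rule poly_eqI) (simp add: coeff_ddx_comp rat_deriv_mult algebra_simps split: nat.split)

lemma ddx_comp_diff: "ddx_comp (A - B) = ddx_comp A - ddx_comp B"
  by (rule poly_eqI) (simp add: coeff_ddx_comp rat_deriv_diff split: nat.split)

lemma ddx_comp_0 [simp]: "ddx_comp 0 = 0"
  by (simp add: ddx_comp_def)

lemma ddx_comp_sum: "ddx_comp (\<Sum>i\<in>I. f i) = (\<Sum>i\<in>I. ddx_comp (f i))"
  by (induction I rule: infinite_finite_induct) (simp_all add: ddx_comp_add)

lemma dop_comp_first_order: "dop_comp [:- g, 1:] B = ddx_comp B - Polynomial.smult g B"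
  by (simp add: dop_comp_def atMost_Suc)

lemma factor_chain_monic: "degree (factor_chain g N) = N \<and> lead_coeff (factor_chain g N) = 1"
proof (induction N)
  case (Suc N)
  let ?A = "factor_chain g N"
  have c: "coeff (factor_chain g (Suc N)) (Suc N) = 1"
  proof -
    have "degree ?A = N" using Suc by blast
    then have "coeff ?A (Suc N) = 0" by (simp add: coeff_eq_0)
    moreover have "coeff ?A N = 1" using Suc by metis
    ultimately show ?thesis by (simp add: coeff_ddx_comp)
  qed
  moreover have "degree (factor_chain g (Suc N)) \<le> Suc N"
    using Suc degree_ddx_comp[of ?A]
    by (auto intro!: degree_diff_le degree_smult_le[THEN order_trans])
  ultimately have "degree (factor_chain g (Suc N)) = Suc N"
    by (metis le_degree le_antisym zero_neq_one)
  with c show ?case by metis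
qed simp

lemma degree_factor_chain [simp]: "degree (factor_chain g N) = N"
  and coeff_factor_chain_lead [simp]: "coeff (factor_chain g N) N = 1"
proof -
  have *: "degree (factor_chain g N) = N" "lead_coeff (factor_chain g N) = 1"
    using factor_chain_monic by blast+
  show "degree (factor_chain g N) = N" by (fact *(1))
  show "coeff (factor_chain g N) N = 1" using *(2) unfolding *(1) .
qed

text \<open>This is composition with \<open>d/dx\<close> on the left, written in the variable \<open>w\<close> with \<open>x = \<phi>(w)\<close>.\<close>

definition ddx_in :: "ratfun \<Rightarrow> diffop \<Rightarrow> diffop" where
  "ddx_in \<phi> B = Polynomial.smult (1 / rat_deriv \<phi>) (ddx_comp B)"

lemma dop_pullback_bound:
  "degree A \<le> N \<Longrightarrow> dop_pullback \<phi> A =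
     (\<Sum>k\<le>N. Polynomial.smult (rat_comp (coeff A k) \<phi>) ((ddx_in \<phi> ^^ k) 1))"
  unfolding dop_pullback_def ddx_in_def[abs_def]
  by (rule sum.mono_neutral_left) (auto simp: coeff_eq_0)

text \<open>By the chain rule \<open>(1/\<phi>') d/dw\<close> maps \<open>a(\<phi>)\<close> to \<open>a'(\<phi>)\<close>, so both sides have the same product rule.\<close>

lemma dop_pullback_ddx_comp:
  assumes "\<phi> \<notin> range rat_const" and "rat_deriv \<phi> \<noteq> 0"
  shows "dop_pullback \<phi> (ddx_comp A) = ddx_in \<phi> (dop_pullback \<phi> A)"
proof -
  define N where "N = degree A"
  define P where "P k = (ddx_in \<phi> ^^ k) 1" for k
  define c where "c k = rat_comp (coeff A k) \<phi>" for k
  define c' where "c' k = rat_comp (rat_deriv (coeff A k)) \<phi>" for k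
  have "dop_pullback \<phi> (ddx_comp A) =
      (\<Sum>k\<le>Suc N. Polynomial.smult (rat_comp (coeff (ddx_comp A) k) \<phi>) (P k))"
    unfolding P_def N_def by (rule dop_pullback_bound) (rule degree_ddx_comp)
  also have "\<dots> = (\<Sum>k\<le>Suc N. Polynomial.smult (case k of 0 \<Rightarrow> 0 | Suc j \<Rightarrow> c j) (P k)) +
      (\<Sum>k\<le>Suc N. Polynomial.smult (c' k) (P k))"
    unfolding sum.distrib[symmetric] c_def c'_def
    by (intro sum.cong refl)
       (auto simp: coeff_ddx_comp rat_comp_add[OF assms(1)] smult_add_left split: nat.split)
  also have "(\<Sum>k\<le>Suc N. Polynomial.smult (case k of 0 \<Rightarrow> 0 | Suc j \<Rightarrow> c j) (P k)) =
      (\<Sum>k\<le>N. Polynomial.smult (c k) (P (Suc k)))"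
    by (subst sum.atMost_Suc_shift) simp
  also have "(\<Sum>k\<le>Suc N. Polynomial.smult (c' k) (P k)) = (\<Sum>k\<le>N. Polynomial.smult (c' k) (P k))"
    by (simp add: c'_def N_def coeff_eq_0)
  also have "(\<Sum>k\<le>N. Polynomial.smult (c k) (P (Suc k))) + (\<Sum>k\<le>N. Polynomial.smult (c' k) (P k)) =
      (\<Sum>k\<le>N. ddx_in \<phi> (Polynomial.smult (c k) (P k)))"
    unfolding sum.distrib[symmetric]
  proof (intro sum.cong refl)
    fix k
    have "rat_deriv (c k) = c' k * rat_deriv \<phi>"
      unfolding c_def c'_def by (rule rat_deriv_rat_comp[OF assms(1)])
    then show "Polynomial.smult (c k) (P (Suc k)) + Polynomial.smult (c' k) (P k) =
        ddx_in \<phi> (Polynomial.smult (c k) (P k))"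
      using assms(2) by (simp add: P_def ddx_in_def ddx_comp_smult smult_add_right)
  qed
  also have "\<dots> = ddx_in \<phi> (dop_pullback \<phi> A)"
    by (simp add: dop_pullback_bound[of A N] N_def ddx_in_def ddx_comp_sum P_def c_def
        smult_sum_right)
  finally show ?thesis .
qed

lemma dop_pullback_smult:
  assumes "\<phi> \<notin> range rat_const"
  shows "dop_pullback \<phi> (Polynomial.smult q A) = Polynomial.smult (rat_comp q \<phi>) (dop_pullback \<phi> A)"
  by (simp add: dop_pullback_bound[of _ "degree A"] degree_smult_le rat_comp_mult[OF assms] smult_sum_right)

lemma dop_pullback_diff:
  assumes "\<phi> \<notin> range rat_const"
  shows "dop_pullback \<phi> (A - B) = dop_pullback \<phi> A - dop_pullback \<phi> B"
proof -
  define N where "N = max (degree A) (degree B)"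
  have "degree (A - B) \<le> N" "degree A \<le> N" "degree B \<le> N"
    unfolding N_def by (auto simp: degree_diff_le_max)
  then show ?thesis
    by (simp add: dop_pullback_bound[of _ N] rat_comp_diff[OF assms] smult_diff_left sum_subtractf)
qed

text \<open>With \<open>u = 1/\<phi>'\<close>, the pullback of \<open>d/dx - g\<close> is \<open>u (d/dw - \<phi>' g(\<phi>))\<close>. Moving the factors
  \<open>u\<close> of a product to the left shifts the \<open>i\<close>-th first order factor by \<open>(i - 1) u'/u = - (i - 1) \<phi>''/\<phi>'\<close>.\<close>

definition local_factor :: "ratfun \<Rightarrow> (nat \<Rightarrow> ratfun) \<Rightarrow> nat \<Rightarrow> ratfun" where
  "local_factor \<phi> g i = rat_deriv \<phi> * rat_comp (g i) \<phi> +
     of_nat (i - 1) * (rat_deriv (rat_deriv \<phi>) / rat_deriv \<phi>)"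

lemma dop_pullback_factor_chain:
  assumes "\<phi> \<notin> range rat_const" and d: "rat_deriv \<phi> \<noteq> 0"
  shows "dop_pullback \<phi> (factor_chain g N) =
     Polynomial.smult ((1 / rat_deriv \<phi>) ^ N) (factor_chain (local_factor \<phi> g) N)"
proof (induction N)
  case 0
  then show ?case by (simp add: dop_pullback_def)
next
  case (Suc N)
  define u where "u = 1 / rat_deriv \<phi>"
  let ?C = "factor_chain (local_factor \<phi> g) N"
  have u: "rat_deriv (u ^ N) = - of_nat N * u ^ N * (rat_deriv (rat_deriv \<phi>) / rat_deriv \<phi>)"
  proof -
    have "rat_deriv u = - u * (rat_deriv (rat_deriv \<phi>) / rat_deriv \<phi>)"
      using d by (simp add: u_def rat_deriv_inverse power2_eq_square)
    then show ?thesis unfolding rat_deriv_power by (cases N) (simp_all del: of_nat_Suc)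
  qed
  have "dop_pullback \<phi> (factor_chain g (Suc N)) =
      ddx_in \<phi> (Polynomial.smult (u ^ N) ?C) -
      Polynomial.smult (rat_comp (g (Suc N)) \<phi>) (Polynomial.smult (u ^ N) ?C)"
    using Suc
    by (simp add: dop_pullback_diff[OF assms(1)] dop_pullback_ddx_comp[OF assms]
        dop_pullback_smult[OF assms(1)] u_def)
  also have "\<dots> = Polynomial.smult (u ^ Suc N) (factor_chain (local_factor \<phi> g) (Suc N))"
  proof (rule poly_eqI)
    fix k
    have g: "rat_comp (g (Suc N)) \<phi> = u * (rat_deriv \<phi> * rat_comp (g (Suc N)) \<phi>)"
      using d by (simp add: u_def)
    show "coeff (ddx_in \<phi> (Polynomial.smult (u ^ N) ?C) -
        Polynomial.smult (rat_comp (g (Suc N)) \<phi>) (Polynomial.smult (u ^ N) ?C)) k =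
      coeff (Polynomial.smult (u ^ Suc N) (factor_chain (local_factor \<phi> g) (Suc N))) k"
      by (subst g) (simp add: ddx_in_def ddx_comp_smult u local_factor_def u_def[symmetric]
          algebra_simps)
  qed
  finally show ?case unfolding u_def .
qed

lemma local_op_factor_chain:
  assumes "local_coord P \<notin> range rat_const" and d: "rat_deriv (local_coord P) \<noteq> 0"
  shows "local_op (factor_chain g N) P = factor_chain (local_factor (local_coord P) g) N"
  using d by (simp add: local_op_def dop_pullback_factor_chain[OF assms] Let_def)

lemma nonconst_local_coord: "local_coord P \<notin> range rat_const"
proof (cases P)
  case (Pt p)
  then show ?thesis by auto
next
  case Infty
  have False if "1 / rat_X = rat_const c" for c
  proof -
    have "rat_X \<noteq> 0" by simp
    with that have "1 = rat_const c * rat_X" by (simp add: field_simps)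
    then have "to_fract 1 = to_fract ([:c:] * [:0, 1:])" by (simp only: to_fract_mult to_fract_1)
    then have "1 = [:c:] * [:0, 1:]" by (simp only: to_fract_eq_iff)
    then have "poly 1 0 = poly ([:c:] * [:0, 1:]) 0" by simp
    then show False by simp
  qed
  then show ?thesis using Infty by auto
qed

lemma rat_deriv_local_coord_Pt: "rat_deriv (local_coord (Pt p)) = 1"
  by (simp add: pderiv_pCons)

lemma rat_deriv_local_coord_Infty: "rat_deriv (local_coord Infty) = - 1 / rat_X\<^sup>2"
  by (simp add: rat_deriv_inverse pderiv_pCons)

lemma local_op_chain:
  "local_op (factor_chain g N) P = factor_chain (local_factor (local_coord P) g) N"
proof (rule local_op_factor_chain[OF nonconst_local_coord])
  show "rat_deriv (local_coord P) \<noteq> 0"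
    using rat_deriv_local_coord_Pt rat_deriv_local_coord_Infty by (cases P) (simp_all del: local_coord.simps)
qed

section \<open>Indicial polynomials of products of first order operators\<close>

text \<open>The order \<open>N\<close> is a separate argument so that the definition fits inductions on the number of
  factors. An operator with coefficients \<open>a\<^sub>k\<close> such that \<open>w\<^sup>N\<^sup>-\<^sup>k a\<^sub>k\<close> is regular at 0 maps \<open>w\<^sup>\<rho>\<close> to
  \<open>f(\<rho>) w\<^sup>\<rho>\<^sup>-\<^sup>N\<close> up to higher order terms, where \<open>f\<close> is this polynomial.\<close>

definition indicial_sum :: "nat \<Rightarrow> diffop \<Rightarrow> complex poly" where
  "indicial_sum N A = (\<Sum>k\<le>N. Polynomial.smult (rat_eval (rat_X ^ (N - k) * coeff A k) 0)
     (\<Prod>j<k. [:- of_nat j, 1:]))"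

text \<open>Applied to \<open>w\<^sup>\<rho>\<^sup>-\<^sup>N\<close>, the factor \<open>d/dw - g\<close> gives \<open>(\<rho> - N - (w g)(0)) w\<^sup>\<rho>\<^sup>-\<^sup>N\<^sup>-\<^sup>1\<close> up to higher order terms.\<close>

lemma indicial_sum_factor_chain:
  assumes "\<And>i. i \<in> {1..N} \<Longrightarrow> \<not> rat_pole (rat_X * g i) 0"
  shows "(\<forall>k\<le>N. \<not> rat_pole (rat_X ^ (N - k) * coeff (factor_chain g N) k) 0) \<and>
    indicial_sum N (factor_chain g N) =
      (\<Prod>i=1..N. [:- (rat_eval (rat_X * g i) 0 + of_nat (i - 1)), 1:])"
  using assms
proof (induction N)
  case 0
  then show ?case by (simp add: indicial_sum_def)
next
  case (Suc N)
  let ?A = "factor_chain g N" and ?B = "factor_chain g (Suc N)"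
  let ?g0 = "rat_eval (rat_X * g (Suc N)) 0"
  define c where "c k = rat_X ^ (N - k) * coeff ?A k" for k
  define F where "F k = (\<Prod>j<k. [:- of_nat j, 1 :: complex:])" for k
  have c: "\<not> rat_pole (c k) 0" if "k \<le> N" for k
    using Suc.IH Suc.prems that unfolding c_def by auto
  have g: "\<not> rat_pole (rat_X * g (Suc N)) 0" using Suc.prems by simp
  have X: "rat_X * rat_deriv (c k) = of_nat (N - k) * c k + rat_X ^ (Suc N - k) * rat_deriv (coeff ?A k)"
    if "k \<le> N" for k
  proof -
    have "rat_X * rat_deriv (rat_X ^ m) = of_nat m * rat_X ^ m" for m
      unfolding rat_deriv_power by (cases m) (simp_all add: pderiv_pCons del: of_nat_Suc)
    then have "rat_X * rat_deriv (c k) =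
        of_nat (N - k) * rat_X ^ (N - k) * coeff ?A k + rat_X * rat_X ^ (N - k) * rat_deriv (coeff ?A k)"
      by (simp add: c_def rat_deriv_mult distrib_left flip: mult.assoc)
    then show ?thesis using that by (simp add: c_def Suc_diff_le)
  qed
  \<comment> \<open>The derivatives of the coefficients are expressed by those of \<open>c\<close>, because \<open>rat_X * rat_deriv (c k)\<close>
    vanishes at 0.\<close>
  have b: "rat_X ^ (Suc N - k) * coeff ?B k =
      (case k of 0 \<Rightarrow> 0 | Suc j \<Rightarrow> c j) +
      (if k \<le> N then rat_X * rat_deriv (c k) - of_nat (N - k) * c k - rat_X * g (Suc N) * c k else 0)"
    if "k \<le> Suc N" for k
  proof (cases "k \<le> N")
    case True
    then have "rat_X ^ (Suc N - k) * (g (Suc N) * coeff ?A k) = rat_X * g (Suc N) * c k"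
      by (simp add: c_def Suc_diff_le)
    moreover have "rat_X ^ (Suc N - k) * (case k of 0 \<Rightarrow> 0 | Suc j \<Rightarrow> coeff ?A j) =
        (case k of 0 \<Rightarrow> 0 | Suc j \<Rightarrow> c j)"
      by (simp add: c_def split: nat.split)
    ultimately show ?thesis using True X[OF True]
      by (simp add: coeff_ddx_comp right_diff_distrib distrib_left)
  next
    case False
    then have "k = Suc N" using that by simp
    then show ?thesis using coeff_factor_chain_lead[of g "Suc N"]
      by (simp add: c_def del: factor_chain.simps)
  qed
  have r: "\<not> rat_pole (case k of 0 \<Rightarrow> 0 | Suc j \<Rightarrow> c j) 0 \<and>
      rat_eval (case k of 0 \<Rightarrow> 0 | Suc j \<Rightarrow> c j) 0 = (case k of 0 \<Rightarrow> 0 | Suc j \<Rightarrow> rat_eval (c j) 0)"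
    if "k \<le> Suc N" for k
    using that c by (auto split: nat.split)
  have r': "\<not> rat_pole (if k \<le> N then rat_X * rat_deriv (c k) - of_nat (N - k) * c k
        - rat_X * g (Suc N) * c k else 0) 0 \<and>
      rat_eval (if k \<le> N then rat_X * rat_deriv (c k) - of_nat (N - k) * c k
        - rat_X * g (Suc N) * c k else 0) 0 =
      (if k \<le> N then (- of_nat (N - k) - ?g0) * rat_eval (c k) 0 else 0)" for k
  proof (cases "k \<le> N")
    case True
    note c = c[OF True]
    have 1: "\<not> rat_pole (rat_X * rat_deriv (c k)) 0 \<and> rat_eval (rat_X * rat_deriv (c k)) 0 = 0"
      using rat_regular_mult[of rat_X 0 "rat_deriv (c k)"] rat_deriv_regular[OF c] by simp
    have 2: "\<not> rat_pole (of_nat (N - k) * c k) 0 \<and>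
        rat_eval (of_nat (N - k) * c k) 0 = of_nat (N - k) * rat_eval (c k) 0"
      using rat_regular_mult[of "of_nat (N - k)" 0 "c k"] c by simp
    have 3: "\<not> rat_pole (rat_X * g (Suc N) * c k) 0 \<and>
        rat_eval (rat_X * g (Suc N) * c k) 0 = ?g0 * rat_eval (c k) 0"
      using rat_regular_mult[OF g c] by simp
    show ?thesis using True 1 2 3
      by (simp add: rat_pole_diff rat_eval_diff left_diff_distrib)
  qed simp
  have "\<forall>k\<le>Suc N. \<not> rat_pole (rat_X ^ (Suc N - k) * coeff ?B k) 0"
    using b r r' rat_pole_add by (simp del: factor_chain.simps)
  moreover have "indicial_sum (Suc N) ?B = indicial_sum N ?A * [:- (?g0 + of_nat N), 1:]"
  proof -
    have "indicial_sum (Suc N) ?B =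
        (\<Sum>k\<le>Suc N. Polynomial.smult (case k of 0 \<Rightarrow> 0 | Suc j \<Rightarrow> rat_eval (c j) 0) (F k)) +
        (\<Sum>k\<le>Suc N. Polynomial.smult
           (if k \<le> N then (- of_nat (N - k) - ?g0) * rat_eval (c k) 0 else 0) (F k))"
      unfolding indicial_sum_def sum.distrib[symmetric] F_def[symmetric] smult_add_left[symmetric]
      using r r' by (intro sum.cong refl arg_cong2[where f = Polynomial.smult])
        (simp add: b rat_eval_add del: factor_chain.simps)
    also have "\<dots> = (\<Sum>k\<le>N. Polynomial.smult (rat_eval (c k) 0) (F (Suc k))) +
        (\<Sum>k\<le>N. Polynomial.smult ((- of_nat (N - k) - ?g0) * rat_eval (c k) 0) (F k))"
      by (subst sum.atMost_Suc_shift) simp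
    also have "\<dots> = (\<Sum>k\<le>N. Polynomial.smult (rat_eval (c k) 0) (F k) * [:- (?g0 + of_nat N), 1:])"
      unfolding sum.distrib[symmetric]
    proof (intro sum.cong refl)
      fix k assume k: "k \<in> {..N}"
      have "F (Suc k) = F k * [:- of_nat k, 1:]" by (simp add: F_def)
      moreover have "[:- (?g0 + of_nat N), 1:] = [:- of_nat k, 1:] + [:- of_nat (N - k) - ?g0:]"
        using k by (simp add: of_nat_diff)
      ultimately show "Polynomial.smult (rat_eval (c k) 0) (F (Suc k)) +
          Polynomial.smult ((- of_nat (N - k) - ?g0) * rat_eval (c k) 0) (F k) =
          Polynomial.smult (rat_eval (c k) 0) (F k) * [:- (?g0 + of_nat N), 1:]"
        by (simp only: distrib_left) (simp add: algebra_simps smult_add_right)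
    qed
    also have "\<dots> = indicial_sum N ?A * [:- (?g0 + of_nat N), 1:]"
      by (simp only: indicial_sum_def c_def F_def sum_distrib_right)
    finally show ?thesis .
  qed
  moreover have "indicial_sum N ?A = (\<Prod>i=1..N. [:- (rat_eval (rat_X * g i) 0 + of_nat (i - 1)), 1:])"
    using Suc.IH Suc.prems by auto
  moreover have "(\<Prod>i=1..Suc N. [:- (rat_eval (rat_X * g i) 0 + of_nat (i - 1)), 1:]) =
      [:- (?g0 + of_nat N), 1:] * (\<Prod>i=1..N. [:- (rat_eval (rat_X * g i) 0 + of_nat (i - 1)), 1:])"
    by (subst prod.nat_ivl_Suc') simp_all
  ultimately show ?case by (simp only: mult.commute simp_thms)
qed

lemma sum_singleton_mset: "(\<Sum>i\<in>I. {#f i#}) = image_mset f (mset_set I)"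
  by (simp add: sum_unfold_sum_mset)

text \<open>The summand \<open>i - 1\<close> arises because the first \<open>i - 1\<close> factors lower the exponent of \<open>w\<^sup>\<rho>\<close> by \<open>i - 1\<close>
  before the \<open>i\<close>-th one is applied.\<close>

lemma exponents_factor_chain:
  assumes "\<And>i. i \<in> {1..N} \<Longrightarrow> \<not> rat_pole (rat_X * local_factor (local_coord P) g i) 0"
  shows "exponents (factor_chain g N) P = image_mset
      (\<lambda>i. rat_eval (rat_X * local_factor (local_coord P) g i) 0 + of_nat (i - 1)) (mset_set {1..N})"
proof -
  have "exponents (factor_chain g N) P =
      proots (indicial_sum N (factor_chain (local_factor (local_coord P) g) N))"
    by (simp add: exponents_def indicial_poly_def indicial_sum_def local_op_chain)
  also have "\<dots> = (\<Sum>i=1..N. {#rat_eval (rat_X * local_factor (local_coord P) g i) 0 + of_nat (i - 1)#})"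
    using indicial_sum_factor_chain[of N "local_factor (local_coord P) g", OF assms]
    by (simp add: proots_prod del: minus_add_distrib)
  finally show ?thesis unfolding sum_singleton_mset .
qed

lemma regular_singular_factor_chain:
  assumes "\<And>i. i \<in> {1..N} \<Longrightarrow> \<not> rat_pole (rat_X * local_factor (local_coord P) g i) 0"
    and "singular_point (factor_chain g N) P"
  shows "regular_singular_point (factor_chain g N) P"
  using assms(2) indicial_sum_factor_chain[of N "local_factor (local_coord P) g", OF assms(1)]
  by (simp add: regular_singular_point_def local_op_chain)

section \<open>Ordinary points\<close>

definition regular_op :: "diffop \<Rightarrow> complex \<Rightarrow> bool" where
  "regular_op A p \<longleftrightarrow> (\<forall>k. \<not> rat_pole (coeff A k) p)"

lemma regular_op_ddx_comp: "regular_op A p \<Longrightarrow> regular_op (ddx_comp A) p"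
  unfolding regular_op_def coeff_ddx_comp
  by (intro allI rat_pole_add) (simp_all add: rat_deriv_regular split: nat.split)

lemma regular_op_smult: "regular_op A p \<Longrightarrow> \<not> rat_pole q p \<Longrightarrow> regular_op (Polynomial.smult q A) p"
  by (simp add: regular_op_def rat_pole_mult)

lemma regular_op_add: "regular_op A p \<Longrightarrow> regular_op B p \<Longrightarrow> regular_op (A + B) p"
  by (simp add: regular_op_def rat_pole_add)

lemma regular_op_diff: "regular_op A p \<Longrightarrow> regular_op B p \<Longrightarrow> regular_op (A - B) p"
  by (simp add: regular_op_def rat_pole_diff)

lemma regular_op_1: "regular_op 1 p"
  by (simp add: regular_op_def one_pCons coeff_pCons split: nat.split)

text \<open>Two first order factors whose poles cancel. With \<open>g = 1/(x-p) + h\<close> and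
  \<open>g' = -1/(x-p) + h'\<close>, the coefficient \<open>g g' - dg/dx\<close> of
  \<open>(d/dx - g')(d/dx - g)\<close> equals \<open>(h' - h)/(x-p)\<close> up to regular terms.\<close>

lemma regular_op_cancelling_pair:
  assumes A: "regular_op A p"
    and g: "g = 1 / to_fract [:- p, 1:] + h" and g': "g' = - 1 / to_fract [:- p, 1:] + h'"
    and h: "\<not> rat_pole h p" and h': "\<not> rat_pole h' p" and eq: "rat_eval h p = rat_eval h' p"
  defines "B \<equiv> ddx_comp A - Polynomial.smult g A"
  shows "regular_op (ddx_comp B - Polynomial.smult g' B) p"
proof -
  let ?X = "to_fract [:- p, 1:]"
  have X: "?X \<noteq> 0" by simp
  have dg: "rat_deriv g = - 1 / ?X\<^sup>2 + rat_deriv h"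
    unfolding g by (simp add: rat_deriv_add rat_deriv_inverse pderiv_pCons)
  have "g * g' - rat_deriv g = (h' - h) / ?X + (h * h' - rat_deriv h)"
    unfolding dg unfolding g g' using X by (simp add: field_simps power2_eq_square)
  moreover have "\<not> rat_pole ((h' - h) / ?X) p"
    using h h' eq by (intro rat_regular_divide_uniformiser) (simp_all add: rat_pole_diff rat_eval_diff)
  ultimately have 1: "\<not> rat_pole (g * g' - rat_deriv g) p"
    using h h' by (simp add: rat_regular_intros rat_deriv_regular)
  have 2: "\<not> rat_pole (g + g') p"
    using h h' by (simp add: g g' rat_pole_add)
  have "ddx_comp B - Polynomial.smult g' B =
      ddx_comp (ddx_comp A) - Polynomial.smult (g + g') (ddx_comp A) + Polynomial.smult (g * g' - rat_deriv g) A"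
    by (rule poly_eqI) (simp add: B_def ddx_comp_diff ddx_comp_smult algebra_simps)
  then show ?thesis
    using A 1 2 by (simp add: regular_op_add regular_op_diff regular_op_smult regular_op_ddx_comp)
qed

text \<open>The local parameter \<open>w = x - p\<close> turns coefficients at \<open>p\<close> into coefficients at 0.\<close>

lemma poly_at_translate: "poly_at (to_fract [:p, 1:]) a = to_fract (pcompose a [:p, 1:])"
  by (induction a) (simp_all add: poly_at_pCons pcompose_pCons del: mult_pCons_left)

lemma rat_comp_translate_regular:
  assumes "\<not> rat_pole q p"
  shows "\<not> rat_pole (rat_comp q (local_coord (Pt p))) 0"
proof -
  obtain a b where *: "poly b p \<noteq> 0" "q = to_fract a / to_fract b"
    using assms by (rule rat_regularE)
  then have "b \<noteq> 0" by auto
  have "rat_comp q (local_coord (Pt p)) = to_fract (pcompose a [:p, 1:]) / to_fract (pcompose b [:p, 1:])"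
    using rat_comp_fraction[OF nonconst_local_coord[of "Pt p"] \<open>b \<noteq> 0\<close>] unfolding *(2)
    by (simp add: poly_at_translate)
  moreover have "poly (pcompose b [:p, 1:]) 0 \<noteq> 0" using * by (simp add: poly_pcompose)
  ultimately show ?thesis using rat_regular_fraction(1) by blast
qed

lemma ordinary_point:
  assumes "regular_op A p" and "lead_coeff A = 1"
  shows "\<not> singular_point A (Pt p)"
proof -
  have "ddx_in (local_coord (Pt p)) = ddx_comp"
    by (simp add: ddx_in_def[abs_def] pderiv_pCons)
  moreover have "(ddx_comp ^^ k) 1 = monom 1 k" for k
  proof (induction k)
    case (Suc k)
    then show ?case by (auto simp: coeff_ddx_comp intro!: poly_eqI split: nat.split)
  qed simp
  ultimately have B: "dop_pullback (local_coord (Pt p)) A =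
      map_poly (\<lambda>q. rat_comp q (local_coord (Pt p))) A"
    by (intro poly_eqI)
       (auto simp: dop_pullback_bound[of A "degree A"] coeff_sum coeff_map_poly coeff_eq_0
         if_distrib if_distribR cong: if_cong)
  have c: "coeff (map_poly (\<lambda>q. rat_comp q (local_coord (Pt p))) A) k =
      rat_comp (coeff A k) (local_coord (Pt p))" for k
    by (simp add: coeff_map_poly)
  have "degree (map_poly (\<lambda>q. rat_comp q (local_coord (Pt p))) A) = degree A"
  proof (intro antisym)
    show "degree (map_poly (\<lambda>q. rat_comp q (local_coord (Pt p))) A) \<le> degree A"
      by (intro degree_le allI impI) (simp only: c coeff_eq_0 rat_comp_0)
    show "degree A \<le> degree (map_poly (\<lambda>q. rat_comp q (local_coord (Pt p))) A)"
      using assms(2) by (intro le_degree) (simp only: c rat_comp_1 one_neq_zero not_False_eq_True)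
  qed
  then have "local_op A (Pt p) = map_poly (\<lambda>q. rat_comp q (local_coord (Pt p))) A"
    using assms(2) by (simp add: local_op_def B c del: local_coord.simps)
  then show ?thesis
    using assms(1) rat_comp_translate_regular
    by (simp add: singular_point_def regular_op_def c del: local_coord.simps)
qed

section \<open>The factors of the fundamental operator\<close>

text \<open>The partial fraction decomposition of \<open>ln'(y\<^sub>i T\<^sub>i / y\<^sub>i\<^sub>-\<^sub>1)\<close>.\<close>

definition pole_sum :: "nat \<Rightarrow> nat \<Rightarrow> (nat \<Rightarrow> complex) \<Rightarrow> (nat \<Rightarrow> weight) \<Rightarrow>
    (nat \<Rightarrow> nat) \<Rightarrow> (nat \<Rightarrow> nat \<Rightarrow> complex) \<Rightarrow> nat \<Rightarrow> ratfun" where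
  "pole_sum r n z \<Lambda> l t i =
     (\<Sum>j=1..ext_l r l i. 1 / to_fract [:- t i j, 1:])
     - (\<Sum>j=1..ext_l r l (i - 1). 1 / to_fract [:- t (i - 1) j, 1:])
     + lnderiv_T n z \<Lambda> i"

lemma y_poly_nonzero [simp]: "y_poly r l t i \<noteq> 0"
  by (simp add: y_poly_def)

lemma poly_y_poly_eq_0: "poly (y_poly r l t i) p = 0 \<longleftrightarrow> (\<exists>j\<in>{1..ext_l r l i}. t i j = p)"
  by (auto simp: y_poly_def poly_prod)

lemma log_deriv_prod_linear:
  fixes c :: "nat \<Rightarrow> complex"
  assumes "finite J" and "\<And>j. j \<in> J \<Longrightarrow> c j \<noteq> p"
  shows "poly (pderiv (\<Prod>j\<in>J. [:- c j, 1:])) p / poly (\<Prod>j\<in>J. [:- c j, 1:]) p = (\<Sum>j\<in>J. 1 / (p - c j))"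
  using assms
proof (induction J rule: finite_induct)
  case (insert j J)
  define q where "q = (\<Prod>j\<in>J. [:- c j, 1:])"
  have "poly q p \<noteq> 0" "p - c j \<noteq> 0" using insert by (force simp: q_def poly_prod)+
  moreover have "(\<Prod>j\<in>insert j J. [:- c j, 1:]) = [:- c j, 1:] * q"
    by (simp only: prod.insert[OF insert(1,2)] q_def)
  moreover have "poly (pderiv q) p / poly q p = (\<Sum>j\<in>J. 1 / (p - c j))"
    using insert by (simp add: q_def)
  moreover have "poly (pderiv ([:- c j, 1:] * q)) p = (p - c j) * poly (pderiv q) p + poly q p"
    by (simp add: pderiv_mult pderiv_pCons algebra_simps del: mult_pCons_left mult_pCons_right)
  moreover have "poly ([:- c j, 1:] * q) p = (p - c j) * poly q p" by (simp add: algebra_simps)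
  ultimately show ?case by (simp only: sum.insert[OF insert(1,2)]) (simp add: add_divide_distrib)
qed simp

lemma fund_partial_eq: "fund_partial r n z \<Lambda> l t N = factor_chain (pole_sum r n z \<Lambda> l t) N"
proof (induction N)
  case (Suc N)
  have "lnderiv (to_fract (y_poly r l t i) / to_fract (y_poly r l t (i - 1))) + lnderiv_T n z \<Lambda> i =
      pole_sum r n z \<Lambda> l t i" for i
    by (simp add: lnderiv_divide pole_sum_def) (simp add: y_poly_def lnderiv_prod_linear)
  from this[of "Suc N"] show ?case using Suc
    by (simp add: fund_factor_def dop_comp_first_order del: add_uminus_conv_diff minus_add_distrib)
qed simp

lemma fundamental_operator_eq:
  "fundamental_operator r n z \<Lambda> l t = factor_chain (pole_sum r n z \<Lambda> l t) (Suc r)"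
  unfolding fundamental_operator_def fund_partial_eq by simp

lemma scal_alpha: "i \<in> {1..r} \<Longrightarrow> scal r \<mu> (alpha i) = \<mu> i - \<mu> (Suc i)"
proof -
  assume i: "i \<in> {1..r}"
  have "scal r \<mu> (alpha i) =
      (\<Sum>k=1..r+1. (if k = i then \<mu> k else 0) - (if k = Suc i then \<mu> k else 0))"
    unfolding scal_def by (rule sum.cong) (auto simp: alpha_def e_star_def)
  also have "\<dots> = \<mu> i - \<mu> (Suc i)"
    using i unfolding sum_subtractf by (subst (1 2) sum.delta) auto
  finally show ?thesis .
qed

lemma Lambda_infty_eq:
  assumes "i \<in> {1..r+1}"
  shows "Lambda_infty r n \<Lambda> l i =
    (\<Sum>s=1..n. \<Lambda> s i) - of_nat (ext_l r l i) + of_nat (ext_l r l (i - 1))"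
proof -
  have "(\<Sum>j=1..r. of_nat (l j) * alpha j i) =
      (\<Sum>j=1..r. (if j = i then of_nat (l j) else 0) - (if j = i - 1 then of_nat (l j) else 0))"
    using assms by (intro sum.cong) (auto simp: alpha_def e_star_def)
  also have "\<dots> = of_nat (ext_l r l i) - of_nat (ext_l r l (i - 1))"
    unfolding sum_subtractf by (subst (1 2) sum.delta) (auto simp: ext_l_def)
  finally show ?thesis by (simp add: Lambda_infty_def)
qed

text \<open>A point where \<open>y\<^sub>i\<close> vanishes is a zero of neither neighbour. Statements about products of
  the first \<open>N\<close> factors can therefore be proved by adding a single factor between indices where
  \<open>\<epsilon>\<close> fails, or the two factors around an index where \<open>\<epsilon>\<close> holds.\<close>

lemma isolated_index_induct [consumes 3, case_names zero single pair]:
  fixes \<epsilon> P :: "nat \<Rightarrow> bool"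
  assumes "\<not> \<epsilon> N" and "\<not> \<epsilon> 0" and "\<forall>i. \<not> (\<epsilon> i \<and> \<epsilon> (Suc i))"
    and "P 0"
    and "\<And>i. P i \<Longrightarrow> \<not> \<epsilon> i \<Longrightarrow> \<not> \<epsilon> (Suc i) \<Longrightarrow> P (Suc i)"
    and "\<And>i. P i \<Longrightarrow> \<not> \<epsilon> i \<Longrightarrow> \<epsilon> (Suc i) \<Longrightarrow> \<not> \<epsilon> (Suc (Suc i)) \<Longrightarrow> P (Suc (Suc i))"
  shows "P N"
proof -
  have "\<not> \<epsilon> i \<Longrightarrow> P i" for i
  proof (induction i rule: less_induct)
    case (less i)
    show ?case
    proof (cases i)
      case 0
      then show ?thesis using assms(4) by simp
    next
      case (Suc k)
      show ?thesis
      proof (cases "\<epsilon> k")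
        case False
        then show ?thesis using less Suc assms(5)[of k] by simp
      next
        case True
        then obtain m where m: "k = Suc m" using assms(2) by (cases k) auto
        then have "\<not> \<epsilon> m" using True assms(3) by blast
        then show ?thesis using less Suc m True assms(6)[of m] by simp
      qed
    qed
  qed
  then show ?thesis using assms(1) by blast
qed

lemma rat_regular_const_fraction:
  assumes "a \<noteq> p"
  shows "\<not> rat_pole (rat_const c / to_fract [:- a, 1:]) p \<and>
    rat_eval (rat_const c / to_fract [:- a, 1:]) p = c / (p - a)"
  using rat_regular_fraction[of "[:- a, 1:]" p "rat_const c / to_fract [:- a, 1:]" "[:c:]"] assms
  by simp

lemma rat_regular_inverse_linear:
  assumes "a \<noteq> p"
  shows "\<not> rat_pole (1 / to_fract [:- a, 1:]) p \<and> rat_eval (1 / to_fract [:- a, 1:]) p = 1 / (p - a)"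
  using rat_regular_const_fraction[OF assms, of 1] by simp

subsection \<open>Critical points\<close>

locale critical =
  fixes r n :: nat and z :: "nat \<Rightarrow> complex" and \<Lambda> :: "nat \<Rightarrow> weight"
    and l :: "nat \<Rightarrow> nat" and t :: "nat \<Rightarrow> nat \<Rightarrow> complex"
  assumes inj_z: "inj_on z {1..n}" and crit: "critical_point r n z \<Lambda> l t"
begin

abbreviation "L \<equiv> ext_l r l"
abbreviation "y \<equiv> y_poly r l t"
abbreviation "g \<equiv> pole_sum r n z \<Lambda> l t"

lemma L_outside: "i \<notin> {1..r} \<Longrightarrow> L i = 0"
  by (auto simp: ext_l_def)

lemma y_outside: "i \<notin> {1..r} \<Longrightarrow> y i = 1"
  by (simp add: y_poly_def L_outside)

lemma index_in_range: "j \<in> {1..L i} \<Longrightarrow> i \<in> {1..r} \<and> j \<in> {1..l i}"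
  by (auto simp: ext_l_def split: if_splits)

lemma t_inj: "inj_on (t i) {1..L i}"
proof (rule inj_onI)
  fix j k assume *: "j \<in> {1..L i}" "k \<in> {1..L i}" "t i j = t i k"
  from *(1,2) have "i \<in> {1..r}" "j \<in> {1..l i}" "k \<in> {1..l i}" using index_in_range by blast+
  then show "j = k" using crit *(3) unfolding critical_point_def by metis
qed

lemma t_neighbours: "j \<in> {1..L i} \<Longrightarrow> k \<in> {1..L (Suc i)} \<Longrightarrow> t i j \<noteq> t (Suc i) k"
proof -
  assume *: "j \<in> {1..L i}" "k \<in> {1..L (Suc i)}"
  then have "i \<in> {1..<r}" "j \<in> {1..l i}" "k \<in> {1..l (i + 1)}"
    using index_in_range[of j i] index_in_range[of k "Suc i"] by auto
  then show ?thesis using crit unfolding critical_point_def by (metis Suc_eq_plus1)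
qed

lemma y_neighbours: "poly (y i) p = 0 \<Longrightarrow> poly (y (Suc i)) p = 0 \<Longrightarrow> False"
  unfolding poly_y_poly_eq_0 using t_neighbours by metis

lemma t_eq_z:
  assumes "j \<in> {1..L i}" "s \<in> {1..n}" "t i j = z s"
  shows "\<Lambda> s i = \<Lambda> s (Suc i)"
proof -
  have i: "i \<in> {1..r}" "j \<in> {1..l i}" using assms(1) index_in_range by blast+
  then have "scal r (\<Lambda> s) (alpha i) = 0"
    using crit assms(2,3) unfolding critical_point_def by metis
  then show ?thesis using i scal_alpha by simp
qed

text \<open>The critical point equation for \<open>t\<^sub>j\<^bsup>(i)\<^esup>\<close>, arranged so that the two sides are the values at
  \<open>t\<^sub>j\<^bsup>(i)\<^esup>\<close> of the regular parts of the \<open>i\<close>-th and of the \<open>(i+1)\<close>-st factor.\<close>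

lemma bethe_equation:
  assumes j: "j \<in> {1..L i}" and p: "p = t i j" "p \<notin> z ` {1..n}"
  shows "(\<Sum>k\<in>{1..L i} - {j}. 1 / (p - t i k)) - (\<Sum>k=1..L (i - 1). 1 / (p - t (i - 1) k))
      + (\<Sum>s=1..n. - \<Lambda> s i / (p - z s)) =
    (\<Sum>k=1..L (Suc i). 1 / (p - t (Suc i) k)) - (\<Sum>k\<in>{1..L i} - {j}. 1 / (p - t i k))
      + (\<Sum>s=1..n. - \<Lambda> s (Suc i) / (p - z s))"
proof -
  have i: "i \<in> {1..r}" "j \<in> {1..l i}" using j index_in_range by blast+
  have "L i = l i" using i by (simp add: ext_l_def)
  define \<sigma> where "\<sigma> s = scal r (\<Lambda> s) (alpha i)" for s
  have "(\<Sum>s\<in>{s\<in>{1..n}. \<sigma> s \<noteq> 0}. \<sigma> s / (p - z s)) = (\<Sum>s=1..n. \<sigma> s / (p - z s))"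
    by (rule sum.mono_neutral_left) auto
  also have "\<dots> = (\<Sum>s=1..n. - \<Lambda> s (Suc i) / (p - z s)) - (\<Sum>s=1..n. - \<Lambda> s i / (p - z s))"
    using i(1) by (simp add: \<sigma>_def scal_alpha diff_divide_distrib sum_subtractf sum_negf)
  finally have 1: "(\<Sum>s\<in>{s\<in>{1..n}. \<sigma> s \<noteq> 0}. \<sigma> s / (p - z s)) = \<dots>" .
  have 2: "(\<Sum>s\<in>{s\<in>{1..n}. \<sigma> s \<noteq> 0}. \<sigma> s / (p - z s))
        - (\<Sum>s\<in>{1..l i} - {j}. 2 / (p - t i s))
        + (\<Sum>s=1..L (i - 1). 1 / (p - t (i - 1) s))
        + (\<Sum>s=1..L (Suc i). 1 / (p - t (Suc i) s)) = 0"
    using crit i unfolding critical_point_def \<sigma>_def p(1) Suc_eq_plus1 by blast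
  have 3: "(\<Sum>s\<in>{1..l i} - {j}. 2 / (p - t i s)) = 2 * (\<Sum>s\<in>{1..l i} - {j}. 1 / (p - t i s))"
    by (simp add: sum_distrib_left)
  have "A - B + U = C - A + V" if "S - A' + B + C = 0" "A' = 2 * A" "S = V - U"
    for A A' B C S U V :: complex
  proof -
    have "(A - B + U) - (C - A + V) = - (S - A' + B + C)" unfolding that(2,3) by simp
    then show ?thesis by (simp only: that(1) minus_zero right_minus_eq)
  qed
  from this[OF 2 3 1] show ?thesis unfolding \<open>L i = l i\<close> .
qed

lemma y_simple_root:
  assumes "poly (y i) p = 0"
  obtains q where "y i = [:- p, 1:] * q" and "poly q p \<noteq> 0"
    and "\<exists>j\<in>{1..L i}. t i j = p \<and> poly (pderiv q) p / poly q p = (\<Sum>k\<in>{1..L i} - {j}. 1 / (p - t i k))"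
proof -
  obtain j where j: "j \<in> {1..L i}" "t i j = p" using assms unfolding poly_y_poly_eq_0 by blast
  have other: "t i k \<noteq> p" if "k \<in> {1..L i} - {j}" for k
    using inj_onD[OF t_inj[of i], of k j] j that by auto
  define q where "q = (\<Prod>k\<in>{1..L i} - {j}. [:- t i k, 1:])"
  show ?thesis
  proof (rule that[of q])
    show "y i = [:- p, 1:] * q"
      unfolding y_poly_def q_def using j by (subst prod.remove[of _ j]) auto
    show "poly q p \<noteq> 0" using other by (force simp: q_def poly_prod)
    show "\<exists>j\<in>{1..L i}. t i j = p \<and> poly (pderiv q) p / poly q p = (\<Sum>k\<in>{1..L i} - {j}. 1 / (p - t i k))"
      using j other unfolding q_def by (intro bexI[of _ j] conjI log_deriv_prod_linear) auto
  qed
qed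

lemma y_log_deriv:
  assumes "poly (y i) p \<noteq> 0"
  shows "poly (pderiv (y i)) p / poly (y i) p = (\<Sum>j=1..L i. 1 / (p - t i j))"
  using assms unfolding poly_y_poly_eq_0 unfolding y_poly_def by (intro log_deriv_prod_linear) auto

text \<open>If \<open>y\<^sub>i = (x - p) q\<close>, then \<open>y\<^sub>i'(p) = q(p)\<close> and \<open>y\<^sub>i''(p) = 2 q'(p)\<close>. So the sum over the roots of
  \<open>y\<^sub>i\<close> other than \<open>p\<close> in the critical point equation is half of \<open>y\<^sub>i''/y\<^sub>i'\<close> at \<open>p\<close>.\<close>

lemma bethe_polynomials:
  assumes zero: "poly (y i) p = 0" and p: "p \<notin> z ` {1..n}"
  shows "poly (pderiv (pderiv (y i))) p = poly (pderiv (y i)) p *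
    (poly (pderiv (y (i - 1))) p / poly (y (i - 1)) p + poly (pderiv (y (Suc i))) p / poly (y (Suc i)) p
     + (\<Sum>s=1..n. - \<Lambda> s (Suc i) / (p - z s)) - (\<Sum>s=1..n. - \<Lambda> s i / (p - z s)))"
proof -
  obtain q j where q: "y i = [:- p, 1:] * q" "poly q p \<noteq> 0" "j \<in> {1..L i}" "t i j = p"
      "poly (pderiv q) p / poly q p = (\<Sum>k\<in>{1..L i} - {j}. 1 / (p - t i k))"
    using y_simple_root[OF zero] by metis
  have "i \<noteq> 0" using index_in_range[OF q(3)] by simp
  then have "poly (y (i - 1)) p \<noteq> 0" "poly (y (Suc i)) p \<noteq> 0"
    using y_neighbours[of i p] y_neighbours[of "i - 1" p] zero by auto
  note ld = this[THEN y_log_deriv]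
  have d: "poly (pderiv (y i)) p = poly q p" "poly (pderiv (pderiv (y i))) p = 2 * poly (pderiv q) p"
    unfolding q(1) by (simp_all add: pderiv_mult pderiv_pCons pderiv_add pderiv_smult pderiv_diff)
  have "2 * A = B + C + V - U" if "A - B + U = C - A + V" for A B C U V :: complex
    using that by (simp add: algebra_simps mult_2)
  from this[OF bethe_equation[OF q(3) q(4)[symmetric] p]]
  have "2 * (poly (pderiv q) p / poly q p) = poly (pderiv (y (i - 1))) p / poly (y (i - 1)) p
     + poly (pderiv (y (Suc i))) p / poly (y (Suc i)) p
     + (\<Sum>s=1..n. - \<Lambda> s (Suc i) / (p - z s)) - (\<Sum>s=1..n. - \<Lambda> s i / (p - z s))"
    unfolding ld q(5) .
  then show ?thesis unfolding d using q(2) by (metis nonzero_mult_div_cancel_left times_divide_eq_right mult.left_commute)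
qed

lemma lnderiv_T_regular:
  assumes "p \<notin> z ` {1..n}"
  shows "\<not> rat_pole (lnderiv_T n z \<Lambda> i) p \<and>
    rat_eval (lnderiv_T n z \<Lambda> i) p = (\<Sum>s=1..n. - \<Lambda> s i / (p - z s))"
proof -
  have "\<not> rat_pole (rat_const (- \<Lambda> s i) / to_fract [:- z s, 1:]) p \<and>
      rat_eval (rat_const (- \<Lambda> s i) / to_fract [:- z s, 1:]) p = - \<Lambda> s i / (p - z s)"
    if "s \<in> {1..n}" for s
    using that assms rat_regular_const_fraction[of "z s" p "- \<Lambda> s i"] by force
  then show ?thesis unfolding lnderiv_T_def
    using rat_regular_sum[of "{1..n}" "\<lambda>s. rat_const (- \<Lambda> s i) / to_fract [:- z s, 1:]" p]
    by (metis (no_types, lifting) sum.cong)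
qed

lemma y_pole_sum_regular:
  assumes "J \<subseteq> {1..L i}" "\<And>j. j \<in> J \<Longrightarrow> t i j \<noteq> p"
  shows "\<not> rat_pole (\<Sum>j\<in>J. 1 / to_fract [:- t i j, 1:]) p \<and>
    rat_eval (\<Sum>j\<in>J. 1 / to_fract [:- t i j, 1:]) p = (\<Sum>j\<in>J. 1 / (p - t i j))"
  using rat_regular_sum[of J "\<lambda>j. 1 / to_fract [:- t i j, 1:]" p]
    rat_regular_inverse_linear[of _ p] assms(2)
  by (metis (no_types, lifting) sum.cong)

lemma factor_regular:
  assumes "p \<notin> z ` {1..n}" "poly (y i) p \<noteq> 0" "poly (y (i - 1)) p \<noteq> 0"
  shows "\<not> rat_pole (g i) p \<and> rat_eval (g i) p =
    poly (pderiv (y i)) p / poly (y i) p - poly (pderiv (y (i - 1))) p / poly (y (i - 1)) p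
    + (\<Sum>s=1..n. - \<Lambda> s i / (p - z s))"
proof -
  have y: "\<not> rat_pole (\<Sum>j=1..L k. 1 / to_fract [:- t k j, 1:]) p \<and>
      rat_eval (\<Sum>j=1..L k. 1 / to_fract [:- t k j, 1:]) p = poly (pderiv (y k)) p / poly (y k) p"
    if "poly (y k) p \<noteq> 0" for k
  proof -
    have "(\<Sum>j=1..L k. 1 / to_fract [:- t k j, 1:]) = lnderiv (to_fract (y k))"
      unfolding y_poly_def by (subst lnderiv_prod_linear) auto
    also have "\<dots> = to_fract (pderiv (y k)) / to_fract (y k)" by (simp add: lnderiv_def)
    finally show ?thesis using rat_regular_fraction[OF that] by metis
  qed
  show ?thesis
    using y[OF assms(2)] y[OF assms(3)] lnderiv_T_regular[OF assms(1), of i]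
    unfolding pole_sum_def
    by (simp add: rat_pole_add rat_pole_diff rat_eval_add rat_eval_diff)
qed

text \<open>A zero \<open>p\<close> of \<open>y\<^sub>i\<close> gives the factors \<open>i\<close> and \<open>i + 1\<close> opposite poles at \<open>p\<close>, and by the critical point
  equation these cancel. No other factor has a pole at \<open>p\<close> that is not cancelled in the same way,
  since neighbouring \<open>y\<^sub>i\<close> have no common zeros.\<close>

lemma fundamental_regular:
  assumes p: "p \<notin> z ` {1..n}"
  shows "regular_op (factor_chain g (Suc r)) p"
proof -
  define \<epsilon> where "\<epsilon> i \<longleftrightarrow> poly (y i) p = 0" for i
  define N where "N = Suc r"
  have "\<not> \<epsilon> N" "\<not> \<epsilon> 0" by (simp_all add: \<epsilon>_def N_def y_outside)
  moreover have "\<forall>i. \<not> (\<epsilon> i \<and> \<epsilon> (Suc i))"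
    unfolding \<epsilon>_def using y_neighbours by blast
  ultimately have "regular_op (factor_chain g N) p"
  proof (induction N rule: isolated_index_induct)
    case zero
    then show ?case by (simp add: regular_op_1)
  next
    case (single i)
    then show ?case using factor_regular[OF p, of "Suc i"]
      by (simp add: \<epsilon>_def regular_op_diff regular_op_smult regular_op_ddx_comp)
  next
    case (pair i)
    then obtain j where j: "j \<in> {1..L (Suc i)}" "t (Suc i) j = p"
      unfolding \<epsilon>_def poly_y_poly_eq_0 by blast
    have prev: "t i k \<noteq> p" if "k \<in> {1..L i}" for k
      using pair(2) that unfolding \<epsilon>_def poly_y_poly_eq_0 by blast
    have succ: "t (Suc (Suc i)) k \<noteq> p" if "k \<in> {1..L (Suc (Suc i))}" for k
      using pair(4) that unfolding \<epsilon>_def poly_y_poly_eq_0 by blast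
    have other: "t (Suc i) k \<noteq> p" if "k \<in> {1..L (Suc i)} - {j}" for k
      using inj_onD[OF t_inj[of "Suc i"], of k j] j that by auto
    define a where "a = (\<Sum>k\<in>{1..L (Suc i)} - {j}. 1 / to_fract [:- t (Suc i) k, 1:])"
    define b where "b = (\<Sum>k=1..L i. 1 / to_fract [:- t i k, 1:])"
    define c where "c = (\<Sum>k=1..L (Suc (Suc i)). 1 / to_fract [:- t (Suc (Suc i)) k, 1:])"
    note a = y_pole_sum_regular[of "{1..L (Suc i)} - {j}" "Suc i" p, OF _ other, folded a_def, simplified]
    note b = y_pole_sum_regular[of "{1..L i}" i p, OF _ prev, folded b_def, simplified]
    note c = y_pole_sum_regular[of "{1..L (Suc (Suc i))}" "Suc (Suc i)" p, OF _ succ, folded c_def, simplified]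
    note T = lnderiv_T_regular[OF p]
    have sp: "(\<Sum>k=1..L (Suc i). 1 / to_fract [:- t (Suc i) k, 1:]) = 1 / to_fract [:- p, 1:] + a"
      unfolding a_def using j by (subst sum.remove[of _ j]) auto
    show ?case unfolding factor_chain.simps
    proof (rule regular_op_cancelling_pair[OF pair(1)])
      show "g (Suc i) = 1 / to_fract [:- p, 1:] + (a - b + lnderiv_T n z \<Lambda> (Suc i))"
        unfolding pole_sum_def sp by (simp add: b_def)
      show "g (Suc (Suc i)) = - 1 / to_fract [:- p, 1:] + (c - a + lnderiv_T n z \<Lambda> (Suc (Suc i)))"
        unfolding pole_sum_def diff_Suc_1 sp by (simp add: c_def)
      show "\<not> rat_pole (a - b + lnderiv_T n z \<Lambda> (Suc i)) p"
        "\<not> rat_pole (c - a + lnderiv_T n z \<Lambda> (Suc (Suc i))) p"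
        using a b c T by (simp_all add: rat_pole_add rat_pole_diff)
      show "rat_eval (a - b + lnderiv_T n z \<Lambda> (Suc i)) p = rat_eval (c - a + lnderiv_T n z \<Lambda> (Suc (Suc i))) p"
        using a b c T bethe_equation[OF j(1) j(2)[symmetric] p]
        by (simp add: rat_pole_add rat_pole_diff rat_eval_add rat_eval_diff)
    qed
  qed
  then show ?thesis by (simp only: N_def)
qed

subsection \<open>Residues and exponents\<close>

text \<open>At infinity \<open>dx/(x - a) = - dw/(w (1 - a w))\<close>, so each fraction contributes \<open>- 1\<close> to the residue,
  whatever \<open>a\<close> is. At a finite point only the fraction with its pole there contributes.\<close>

lemma residue_at_point:
  "\<not> rat_pole (rat_X * rat_comp (1 / to_fract [:- a, 1:]) (local_coord (Pt p))) 0 \<and>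
   rat_eval (rat_X * rat_comp (1 / to_fract [:- a, 1:]) (local_coord (Pt p))) 0 = (if a = p then 1 else 0)"
proof -
  have "rat_comp (1 / to_fract [:- a, 1:]) (local_coord (Pt p)) =
      1 / (to_fract [:p, 1:] - rat_const a)"
    by (subst rat_comp_divide[OF nonconst_local_coord])
       (simp_all only: rat_comp_linear rat_comp_1 local_coord.simps to_fract_linear_nonzero not_False_eq_True)
  also have "\<dots> = 1 / to_fract [:p - a, 1:]" by (simp flip: to_fract_diff)
  finally have *: "rat_comp (1 / to_fract [:- a, 1:]) (local_coord (Pt p)) = 1 / to_fract [:p - a, 1:]" .
  show ?thesis
  proof (cases "a = p")
    case True
    then show ?thesis using * by simp
  next
    case False
    then show ?thesis using * rat_regular_fraction[of "[:p - a, 1:]" 0 "rat_X / to_fract [:p - a, 1:]" "[:0, 1:]"]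
      by simp
  qed
qed

lemma residue_at_infinity:
  "\<not> rat_pole (rat_X * (rat_deriv (local_coord Infty) * rat_comp (1 / to_fract [:- a, 1:]) (local_coord Infty))) 0 \<and>
   rat_eval (rat_X * (rat_deriv (local_coord Infty) * rat_comp (1 / to_fract [:- a, 1:]) (local_coord Infty))) 0 = - 1"
proof -
  have "rat_comp (1 / to_fract [:- a, 1:]) (local_coord Infty) = 1 / (1 / rat_X - rat_const a)"
    by (subst rat_comp_divide[OF nonconst_local_coord])
       (simp_all only: rat_comp_linear rat_comp_1 local_coord.simps to_fract_linear_nonzero not_False_eq_True)
  moreover have "1 / rat_X - rat_const a = to_fract [:1, - a:] / rat_X"
  proof -
    have "to_fract [:1, - a:] = to_fract (1 - [:a:] * [:0, 1:])" by (simp add: one_pCons)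
    also have "\<dots> = 1 - rat_const a * rat_X" by (simp only: to_fract_diff to_fract_mult to_fract_1)
    finally show ?thesis by (simp add: diff_divide_distrib)
  qed
  ultimately have "rat_X * (rat_deriv (local_coord Infty) * rat_comp (1 / to_fract [:- a, 1:]) (local_coord Infty))
      = to_fract (- 1) / to_fract [:1, - a:]"
    unfolding rat_deriv_local_coord_Infty by (simp add: power2_eq_square)
  then show ?thesis using rat_regular_fraction[of "[:1, - a:]" 0 _ "- 1"] by simp
qed

text \<open>Here \<open>\<rho> a\<close> is the residue contributed by \<open>1/(x - a)\<close>, and \<open>\<sigma>\<close> the residue of \<open>\<phi>''/\<phi>'\<close>, which enters
  through the change of variable.\<close>

lemma residue_factor:
  fixes P and \<rho> :: "complex \<Rightarrow> complex"
  defines "R \<equiv> \<lambda>a. rat_X * (rat_deriv (local_coord P) * rat_comp (1 / to_fract [:- a, 1:]) (local_coord P))"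
  assumes R: "\<And>a. \<not> rat_pole (R a) 0 \<and> rat_eval (R a) 0 = \<rho> a"
    and S: "\<not> rat_pole (rat_X * (rat_deriv (rat_deriv (local_coord P)) / rat_deriv (local_coord P))) 0 \<and>
       rat_eval (rat_X * (rat_deriv (rat_deriv (local_coord P)) / rat_deriv (local_coord P))) 0 = \<sigma>"
  shows "\<not> rat_pole (rat_X * local_factor (local_coord P) g i) 0 \<and>
    rat_eval (rat_X * local_factor (local_coord P) g i) 0 =
      (\<Sum>j=1..L i. \<rho> (t i j)) - (\<Sum>j=1..L (i - 1). \<rho> (t (i - 1) j))
      + (\<Sum>s=1..n. - \<Lambda> s i * \<rho> (z s)) + of_nat (i - 1) * \<sigma>"
proof -
  note hom = rat_comp_add[OF nonconst_local_coord] rat_comp_diff[OF nonconst_local_coord]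
    rat_comp_sum[OF nonconst_local_coord] rat_comp_mult[OF nonconst_local_coord]
  define Q where "Q = rat_X * (rat_deriv (rat_deriv (local_coord P)) / rat_deriv (local_coord P))"
  have T: "lnderiv_T n z \<Lambda> i = (\<Sum>s=1..n. rat_const (- \<Lambda> s i) * (1 / to_fract [:- z s, 1:]))"
    by (simp add: lnderiv_T_def)
  have rc: "rat_comp (rat_const c) (local_coord P) = rat_const c" for c
    by (simp add: rat_comp_to_fract poly_at_pCons)
  have "rat_X * local_factor (local_coord P) g i =
      (\<Sum>j=1..L i. R (t i j)) - (\<Sum>j=1..L (i - 1). R (t (i - 1) j))
      + (\<Sum>s=1..n. rat_const (- \<Lambda> s i) * R (z s)) + of_nat (i - 1) * Q"
    unfolding local_factor_def pole_sum_def T hom rc R_def Q_def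
    by (simp add: algebra_simps sum_distrib_left)
  moreover have "\<not> rat_pole (\<Sum>j=1..L k. R (t k j)) 0 \<and>
      rat_eval (\<Sum>j=1..L k. R (t k j)) 0 = (\<Sum>j=1..L k. \<rho> (t k j))" for k
    using rat_regular_sum[of "{1..L k}" "\<lambda>j. R (t k j)" 0] R by simp
  moreover have "\<not> rat_pole (rat_const (- \<Lambda> s i) * R (z s)) 0 \<and>
      rat_eval (rat_const (- \<Lambda> s i) * R (z s)) 0 = - \<Lambda> s i * \<rho> (z s)" for s
    using rat_regular_mult[of "rat_const (- \<Lambda> s i)" 0 "R (z s)"] R rat_regular_to_fract[of "[:- \<Lambda> s i:]"]
    by simp
  then have "\<not> rat_pole (\<Sum>s=1..n. rat_const (- \<Lambda> s i) * R (z s)) 0 \<and>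
      rat_eval (\<Sum>s=1..n. rat_const (- \<Lambda> s i) * R (z s)) 0 = (\<Sum>s=1..n. - \<Lambda> s i * \<rho> (z s))"
    using rat_regular_sum[of "{1..n}" "\<lambda>s. rat_const (- \<Lambda> s i) * R (z s)" 0] by simp
  moreover have "\<not> rat_pole (of_nat (i - 1) * Q) 0 \<and> rat_eval (of_nat (i - 1) * Q) 0 = of_nat (i - 1) * \<sigma>"
    using rat_regular_mult[of "of_nat (i - 1)" 0 Q] S rat_regular_of_nat[of "i - 1" 0] unfolding Q_def by metis
  ultimately show ?thesis
    by (simp only: rat_pole_add rat_pole_diff rat_eval_add rat_eval_diff not_False_eq_True simp_thms)
qed

lemma count_roots: "(\<Sum>j=1..L i. if t i j = p then 1 else 0) = (if poly (y i) p = 0 then 1 else (0::complex))"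
proof (cases "poly (y i) p = 0")
  case True
  then obtain j where j: "j \<in> {1..L i}" "t i j = p" unfolding poly_y_poly_eq_0 by blast
  have "(\<Sum>k=1..L i. if t i k = p then 1 else 0) = (\<Sum>k=1..L i. if k = j then 1 else (0::complex))"
    using j inj_onD[OF t_inj[of i]] by (intro sum.cong) auto
  then show ?thesis using j True by simp
next
  case False
  then have "t i j \<noteq> p" if "j \<in> {1..L i}" for j using that unfolding poly_y_poly_eq_0 by blast
  then show ?thesis using False by simp
qed

lemma residue_at_z:
  assumes s: "s \<in> {1..n}"
  shows "\<not> rat_pole (rat_X * local_factor (local_coord (Pt (z s))) g i) 0 \<and>
    rat_eval (rat_X * local_factor (local_coord (Pt (z s))) g i) 0 =
      (if poly (y i) (z s) = 0 then 1 else 0) - (if poly (y (i - 1)) (z s) = 0 then 1 else 0) - \<Lambda> s i"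
proof -
  have "(\<Sum>k=1..n. - \<Lambda> k i * (if z k = z s then 1 else 0)) = (\<Sum>k=1..n. if k = s then - \<Lambda> k i else 0)"
    using s inj_onD[OF inj_z] by (intro sum.cong) auto
  also have "\<dots> = - \<Lambda> s i" using s by simp
  finally have "(\<Sum>k=1..n. - \<Lambda> k i * (if z k = z s then 1 else 0)) = - \<Lambda> s i" .
  moreover have "rat_deriv (local_coord (Pt (z s))) = 1" by (rule rat_deriv_local_coord_Pt)
  ultimately show ?thesis
    using residue_factor[of "Pt (z s)" "\<lambda>a. if a = z s then 1 else 0" 0 i] residue_at_point[of _ "z s"]
    by (simp add: count_roots[unfolded One_nat_def] del: local_coord.simps)
qed

lemma residue_infinity:
  assumes "i \<in> {1..r+1}"
  shows "\<not> rat_pole (rat_X * local_factor (local_coord Infty) g i) 0 \<and>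
    rat_eval (rat_X * local_factor (local_coord Infty) g i) 0 =
      Lambda_infty r n \<Lambda> l i - 2 * of_nat (i - 1)"
proof -
  have X: "rat_X \<noteq> 0" by simp
  have dd: "rat_deriv (- 1 / rat_X\<^sup>2) = 2 / rat_X ^ 3"
  proof -
    have "rat_deriv (rat_X\<^sup>2) = 2 * rat_X"
      by (simp add: power2_eq_square rat_deriv_mult pderiv_pCons)
    then show ?thesis
      using rat_deriv_inverse[of "rat_X\<^sup>2"] by (simp add: rat_deriv_uminus power2_eq_square power3_eq_cube)
  qed
  have "rat_X * (rat_deriv (rat_deriv (local_coord Infty)) / rat_deriv (local_coord Infty)) = - 2"
    unfolding rat_deriv_local_coord_Infty dd using X by (simp add: power2_eq_square power3_eq_cube)
  moreover have "\<not> rat_pole (- 2) p \<and> rat_eval (- 2) p = - 2" for p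
    using rat_regular_uminus[of "of_nat 2" p] rat_regular_of_nat[of 2 p] by simp
  ultimately show ?thesis
    using residue_factor[of Infty "\<lambda>a. - 1" "- 2" i] residue_at_infinity Lambda_infty_eq[OF assms, of n \<Lambda> l]
    by (simp add: sum_negf del: local_coord.simps)
qed

lemma regular_singular_points:
  assumes "singular_point (factor_chain g (Suc r)) P"
  shows "regular_singular_point (factor_chain g (Suc r)) P \<and> P \<in> Pt ` z ` {1..n} \<union> {Infty}"
proof -
  have P: "P \<in> Pt ` z ` {1..n} \<union> {Infty}"
  proof (rule ccontr)
    assume "P \<notin> Pt ` z ` {1..n} \<union> {Infty}"
    then obtain p where "P = Pt p" "p \<notin> z ` {1..n}" by (cases P) auto
    then show False using assms ordinary_point fundamental_regular factor_chain_monic by blast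
  qed
  have "\<not> rat_pole (rat_X * local_factor (local_coord P) g i) 0" if "i \<in> {1..Suc r}" for i
    using P that residue_at_z residue_infinity by auto
  then show ?thesis using P regular_singular_factor_chain assms by blast
qed

text \<open>If \<open>y\<^sub>i\<close> vanishes at \<open>z\<^sub>s\<close>, the residues of the factors \<open>i\<close> and \<open>i + 1\<close> change by \<open>1\<close> and \<open>- 1\<close>. Since
  then \<open>m\<^sub>s\<^sub>,\<^sub>i = m\<^sub>s\<^sub>,\<^sub>i\<^sub>+\<^sub>1\<close>, this only interchanges their exponents.\<close>

lemma exponents_at_z:
  assumes s: "s \<in> {1..n}"
  shows "exponents (factor_chain g (Suc r)) (Pt (z s)) =
    image_mset (\<lambda>i. - \<Lambda> s i + of_nat (i - 1)) (mset_set {1..r+1})"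
proof -
  define \<epsilon> where "\<epsilon> i \<longleftrightarrow> poly (y i) (z s) = 0" for i
  define e where "e i = (if \<epsilon> i then 1 else 0) - (if \<epsilon> (i - 1) then 1 else 0) - \<Lambda> s i + of_nat (i - 1)" for i
  have ms: "image_mset f (mset_set {1..Suc N}) = add_mset (f (Suc N)) (image_mset f (mset_set {1..N}))"
    for f :: "nat \<Rightarrow> complex" and N
    by (simp add: atLeastAtMostSuc_conv)
  define N where "N = Suc r"
  have "\<not> \<epsilon> N" "\<not> \<epsilon> 0" by (simp_all add: \<epsilon>_def N_def y_outside)
  moreover have "\<forall>i. \<not> (\<epsilon> i \<and> \<epsilon> (Suc i))"
    unfolding \<epsilon>_def using y_neighbours by blast
  ultimately have "image_mset e (mset_set {1..N}) =
      image_mset (\<lambda>i. - \<Lambda> s i + of_nat (i - 1)) (mset_set {1..N})"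
  proof (induction N rule: isolated_index_induct)
    case (single i)
    then have "e (Suc i) = - \<Lambda> s (Suc i) + of_nat (Suc i - 1)" by (simp add: e_def)
    then show ?case unfolding ms single(1) by simp
  next
    case (pair i)
    then obtain j where "j \<in> {1..L (Suc i)}" "t (Suc i) j = z s"
      unfolding \<epsilon>_def poly_y_poly_eq_0 by blast
    then have "\<Lambda> s (Suc i) = \<Lambda> s (Suc (Suc i))" using t_eq_z s by blast
    then have "e (Suc i) = - \<Lambda> s (Suc (Suc i)) + of_nat (Suc (Suc i) - 1)"
      "e (Suc (Suc i)) = - \<Lambda> s (Suc i) + of_nat (Suc i - 1)"
      using pair by (simp_all add: e_def)
    then show ?case unfolding ms pair(1) by (simp add: add_mset_commute)
  qed simp
  moreover have "exponents (factor_chain g (Suc r)) (Pt (z s)) = image_mset e (mset_set {1..Suc r})"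
    using residue_at_z[OF s] by (subst exponents_factor_chain) (simp_all add: e_def[abs_def] \<epsilon>_def del: local_coord.simps)
  ultimately show ?thesis by (simp add: N_def)
qed

lemma exponents_at_infinity:
  "exponents (factor_chain g (Suc r)) Infty =
    image_mset (\<lambda>i. Lambda_infty r n \<Lambda> l i - of_nat (i - 1)) (mset_set {1..r+1})"
proof (subst exponents_factor_chain)
  show "\<not> rat_pole (rat_X * local_factor (local_coord Infty) g i) 0" if "i \<in> {1..Suc r}" for i
    using residue_infinity that by simp
  show "image_mset (\<lambda>i. rat_eval (rat_X * local_factor (local_coord Infty) g i) 0 + of_nat (i - 1))
      (mset_set {1..Suc r}) =
    image_mset (\<lambda>i. Lambda_infty r n \<Lambda> l i - of_nat (i - 1)) (mset_set {1..r+1})"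
    unfolding Suc_eq_plus1 by (intro image_mset_cong) (simp add: residue_infinity del: local_coord.simps)
qed

end

section \<open>Analytic functions on a simply connected surface over the plane\<close>

lemma nonzero_set_open:
  assumes "open W" "f holomorphic_on W"
  shows "open {w \<in> W. f w \<noteq> 0}"
proof -
  have "{w \<in> W. f w \<noteq> 0} = W \<inter> f -` (- {0})" by auto
  then show ?thesis
    using assms holomorphic_on_imp_continuous_on[of f W] continuous_open_preimage[of W f "- {0}"]
    by (simp add: open_Compl)
qed

text \<open>Near a common zero \<open>a\<close> both functions are divisible by \<open>w - a\<close>, and since the zero of \<open>f\<close> is simple,
  the quotient \<open>F\<close> of \<open>f\<close> does not vanish at \<open>a\<close>.\<close>

lemma holomorphic_quotient_simple_zeros:
  assumes "open W" and h: "h holomorphic_on W" and f: "f holomorphic_on W"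
    and zero: "\<And>w. w \<in> W \<Longrightarrow> f w = 0 \<Longrightarrow> deriv f w \<noteq> 0 \<and> h w = 0"
  obtains B where "B holomorphic_on W" and "\<And>w. w \<in> W \<Longrightarrow> h w = B w * f w"
proof
  define B where "B w = (if f w = 0 then deriv h w / deriv f w else h w / f w)" for w
  show "h w = B w * f w" if "w \<in> W" for w
    using zero that by (auto simp: B_def)
  have "B field_differentiable at a" if a: "a \<in> W" for a
  proof -
    define H where "H w = (if f a = 0 then if w = a then deriv h a else (h w - h a) / (w - a) else h w)" for w
    define F where "F w = (if f a = 0 then if w = a then deriv f a else (f w - f a) / (w - a) else f w)" for w
    have hol: "H holomorphic_on W" "F holomorphic_on W"
      unfolding H_def F_def using h f pole_lemma_open[OF h \<open>open W\<close>, of a] pole_lemma_open[OF f \<open>open W\<close>, of a]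
      by (cases "f a = 0"; simp)+
    define U where "U = {w \<in> W. F w \<noteq> 0}"
    have "open U" unfolding U_def by (rule nonzero_set_open[OF \<open>open W\<close> hol(2)])
    have "a \<in> U" unfolding U_def F_def using a zero by auto
    have "(\<lambda>w. H w / F w) holomorphic_on U"
      using hol by (intro holomorphic_intros) (auto simp: U_def elim: holomorphic_on_subset)
    moreover have "H w / F w = B w" if "w \<in> U" for w
      using that zero[OF a] unfolding U_def H_def F_def B_def by (auto split: if_splits)
    ultimately have "B holomorphic_on U" by (metis (no_types, lifting) holomorphic_transform)
    then show ?thesis using \<open>open U\<close> \<open>a \<in> U\<close> holomorphic_on_imp_differentiable_at by blast
  qed
  then show "B holomorphic_on W"
    by (simp add: holomorphic_on_def field_differentiable_at_within)
qed

locale surface =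
  fixes W :: "complex set" and \<pi> :: "complex \<Rightarrow> complex"
  assumes open_W: "open W" and simply_connected_W: "simply_connected W"
    and holo_\<pi>: "\<pi> holomorphic_on W" and deriv_\<pi>: "w \<in> W \<Longrightarrow> deriv \<pi> w \<noteq> 0"
begin

abbreviation "\<delta> \<equiv> ddx_on \<pi>"

lemma ddx_holomorphic: "f holomorphic_on W \<Longrightarrow> \<delta> f holomorphic_on W"
  unfolding ddx_on_def using open_W holo_\<pi> deriv_\<pi> by (intro holomorphic_intros) auto

lemma ddx_power_holomorphic: "f holomorphic_on W \<Longrightarrow> (\<delta> ^^ k) f holomorphic_on W"
  by (induction k) (simp_all add: ddx_holomorphic)

lemma DERIV_ddx:
  "f holomorphic_on W \<Longrightarrow> w \<in> W \<Longrightarrow> (f has_field_derivative \<delta> f w * deriv \<pi> w) (at w)"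
  using holomorphic_derivI[OF _ open_W] deriv_\<pi> by (simp add: ddx_on_def)

lemma DERIV_\<pi>: "w \<in> W \<Longrightarrow> (\<pi> has_field_derivative deriv \<pi> w) (at w)"
  using holomorphic_derivI[OF holo_\<pi> open_W] .

lemma ddxI: "w \<in> W \<Longrightarrow> (f has_field_derivative c * deriv \<pi> w) (at w) \<Longrightarrow> \<delta> f w = c"
  using deriv_\<pi>[of w] DERIV_imp_deriv[of f "c * deriv \<pi> w" w] by (simp add: ddx_on_def)

lemma ddx_cong: "open U \<Longrightarrow> w \<in> U \<Longrightarrow> (\<And>x. x \<in> U \<Longrightarrow> f x = h x) \<Longrightarrow> \<delta> f w = \<delta> h w"
  unfolding ddx_on_def
  by (intro arg_cong2[where f = "(/)"] deriv_cong_ev refl) (auto simp: eventually_nhds)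

lemma DERIV_poly_\<pi>:
  "w \<in> W \<Longrightarrow> ((\<lambda>w. poly a (\<pi> w)) has_field_derivative poly (pderiv a) (\<pi> w) * deriv \<pi> w) (at w)"
  using DERIV_chain2[OF poly_DERIV DERIV_\<pi>] .

lemma poly_\<pi>_holomorphic: "(\<lambda>w. poly a (\<pi> w)) holomorphic_on W"
  using DERIV_poly_\<pi> open_W by (auto simp: holomorphic_on_open)

lemma ddx_poly: "w \<in> W \<Longrightarrow> \<delta> (\<lambda>w. poly a (\<pi> w)) w = poly (pderiv a) (\<pi> w)"
  by (rule ddxI[OF _ DERIV_poly_\<pi>])

lemma DERIV_rat_\<pi>:
  assumes w: "w \<in> W" and q: "\<not> rat_pole q (\<pi> w)"
  shows "((\<lambda>w. rat_eval q (\<pi> w)) has_field_derivative rat_eval (rat_deriv q) (\<pi> w) * deriv \<pi> w) (at w)"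
proof -
  obtain a b where ab: "quot_of_fract q = (a, b)" by fastforce
  have b: "poly b (\<pi> w) \<noteq> 0" using q ab by (simp add: rat_pole_def)
  then have "poly (b\<^sup>2) (\<pi> w) \<noteq> 0" by simp
  moreover have "rat_deriv q = to_fract (pderiv a * b - a * pderiv b) / to_fract (b\<^sup>2)"
    by (simp add: rat_deriv_def ab)
  ultimately have e: "rat_eval (rat_deriv q) (\<pi> w) =
      poly (pderiv a * b - a * pderiv b) (\<pi> w) / poly (b\<^sup>2) (\<pi> w)"
    by (rule rat_regular_fraction(2))
  have "((\<lambda>w. poly a (\<pi> w) / poly b (\<pi> w)) has_field_derivative
      (poly (pderiv a) (\<pi> w) * deriv \<pi> w * poly b (\<pi> w) - poly a (\<pi> w) * (poly (pderiv b) (\<pi> w) * deriv \<pi> w))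
        / (poly b (\<pi> w) * poly b (\<pi> w))) (at w)"
    using b by (intro DERIV_divide DERIV_poly_\<pi> w)
  then show ?thesis
    using b by (simp add: rat_eval_def[of q] ab e power2_eq_square algebra_simps diff_divide_distrib)
qed

lemma antiderivative:
  assumes "f holomorphic_on W"
  obtains F where "F holomorphic_on W" and "\<And>w. w \<in> W \<Longrightarrow> \<delta> F w = f w"
proof -
  have "(\<lambda>w. f w * deriv \<pi> w) holomorphic_on W"
    using assms holo_\<pi> open_W by (intro holomorphic_intros)
  then obtain F where F: "\<And>w. w \<in> W \<Longrightarrow> (F has_field_derivative f w * deriv \<pi> w) (at w)"
    using simply_connected_eq_global_primitive[OF open_W] simply_connected_W by metis
  then have "F holomorphic_on W" using open_W by (auto simp: holomorphic_on_open)
  then show ?thesis by (rule that) (rule ddxI[OF _ F])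
qed

lemma poly_nonzero_open: "open {w \<in> W. poly Y (\<pi> w) \<noteq> 0}"
  by (rule nonzero_set_open[OF open_W poly_\<pi>_holomorphic])

text \<open>If \<open>Y(\<pi>)\<close> vanished identically, then \<open>\<pi>\<close> would be constant, because \<open>W\<close> is connected and \<open>Y\<close> has
  finitely many zeros. So the identity theorem applies.\<close>

lemma agree_off_zeros:
  assumes "Y \<noteq> 0" and f: "f holomorphic_on W" and h: "h holomorphic_on W"
    and eq: "\<And>w. w \<in> W \<Longrightarrow> poly Y (\<pi> w) \<noteq> 0 \<Longrightarrow> f w = h w" and w: "w \<in> W"
  shows "f w = h w"
proof -
  have conn: "connected W" using simply_connected_W simply_connected_imp_connected by blast
  define U where "U = {w \<in> W. poly Y (\<pi> w) \<noteq> 0}"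
  have "open U" unfolding U_def by (rule poly_nonzero_open)
  have "U \<noteq> {}"
  proof
    assume "U = {}"
    then have "\<pi> ` W \<subseteq> {x. poly Y x = 0}" unfolding U_def by blast
    then have "finite (\<pi> ` W)" using poly_roots_finite[OF \<open>Y \<noteq> 0\<close>] finite_subset by blast
    moreover have "connected (\<pi> ` W)"
      using conn holo_\<pi> connected_continuous_image holomorphic_on_imp_continuous_on by blast
    ultimately obtain c where "\<pi> ` W = {c}" using w connected_finite_iff_sing by blast
    then have "deriv \<pi> w = deriv (\<lambda>_. c) w"
      using w open_W by (intro deriv_cong_ev refl) (auto simp: eventually_nhds)
    then show False using deriv_\<pi>[OF w] by simp
  qed
  show ?thesis
    using analytic_continuation_open[OF \<open>open U\<close> open_W \<open>U \<noteq> {}\<close> conn _ f h _ w] eq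
    unfolding U_def by blast
qed

text \<open>The equation \<open>N' y - N y' = M\<close> says that \<open>N/y\<close> is an antiderivative of \<open>M/y\<^sup>2\<close>. The residues of
  \<open>M/y\<^sup>2\<close> at the zeros of \<open>y\<close> vanish exactly when \<open>M' y' = M y''\<close> there. With \<open>a y + b y' = 1\<close> the
  function \<open>M/y\<^sup>2\<close> is the sum of \<open>(- M b/y)'\<close> and of \<open>((M b)' + M a)/y\<close>, and the latter has no poles.\<close>

lemma wronskian_equation_solvable:
  assumes y: "coprime y (pderiv y)" and M: "M holomorphic_on W"
    and res: "\<And>w. w \<in> W \<Longrightarrow> poly y (\<pi> w) = 0 \<Longrightarrow>
      \<delta> M w * poly (pderiv y) (\<pi> w) = M w * poly (pderiv (pderiv y)) (\<pi> w)"
  obtains N where "N holomorphic_on W"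
    and "\<And>w. w \<in> W \<Longrightarrow> \<delta> N w * poly y (\<pi> w) - N w * poly (pderiv y) (\<pi> w) = M w"
proof -
  obtain a b where "a * y + b * pderiv y = gcd y (pderiv y)"
    using bezout_coefficients_fst_snd by blast
  then have ab: "a * y + b * pderiv y = 1" using y by simp
  have ab_at: "poly a x * poly y x + poly b x * poly (pderiv y) x = 1" for x
    using arg_cong[OF ab, of "\<lambda>q. poly q x"] by simp
  have ab'_at: "poly (pderiv a) x * poly y x + poly a x * poly (pderiv y) x
      + poly (pderiv b) x * poly (pderiv y) x + poly b x * poly (pderiv (pderiv y)) x = 0" for x
    using arg_cong[OF ab, of "\<lambda>q. poly (pderiv q) x"]
    by (simp add: pderiv_add pderiv_mult algebra_simps)
  define h where "h w = \<delta> M w * poly b (\<pi> w) + M w * (poly (pderiv b) (\<pi> w) + poly a (\<pi> w))" for w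
  have h: "h holomorphic_on W" unfolding h_def
    by (intro holomorphic_intros M ddx_holomorphic poly_\<pi>_holomorphic)
  have zero: "deriv (\<lambda>w. poly y (\<pi> w)) w \<noteq> 0 \<and> h w = 0" if w: "w \<in> W" "poly y (\<pi> w) = 0" for w
  proof
    let ?x = "\<pi> w"
    have 1: "poly b ?x * poly (pderiv y) ?x = 1" using ab_at[of ?x] w(2) by simp
    then have 2: "poly (pderiv y) ?x \<noteq> 0" by auto
    show "deriv (\<lambda>w. poly y (\<pi> w)) w \<noteq> 0"
      using DERIV_imp_deriv[OF DERIV_poly_\<pi>[OF w(1)]] 2 deriv_\<pi>[OF w(1)] by simp
    have 3: "(poly (pderiv b) ?x + poly a ?x) * poly (pderiv y) ?x = - poly b ?x * poly (pderiv (pderiv y)) ?x"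
      using ab'_at[of ?x] w(2) by (simp add: algebra_simps eq_neg_iff_add_eq_0)
    have "h w * poly (pderiv y) ?x = \<delta> M w * poly (pderiv y) ?x * poly b ?x
        + M w * ((poly (pderiv b) ?x + poly a ?x) * poly (pderiv y) ?x)"
      by (simp add: h_def algebra_simps)
    also have "\<dots> = 0" unfolding 3 res[OF w] by (simp add: algebra_simps)
    finally show "h w = 0" using 2 by simp
  qed
  obtain B where B: "B holomorphic_on W" "\<And>w. w \<in> W \<Longrightarrow> h w = B w * poly y (\<pi> w)"
    using holomorphic_quotient_simple_zeros[OF open_W h poly_\<pi>_holomorphic[of y] zero] by metis
  obtain F where F: "F holomorphic_on W" "\<And>w. w \<in> W \<Longrightarrow> \<delta> F w = B w"
    using antiderivative[OF B(1)] by metis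
  define N where "N w = - M w * poly b (\<pi> w) + poly y (\<pi> w) * F w" for w
  have "N holomorphic_on W" unfolding N_def
    by (intro holomorphic_intros M F poly_\<pi>_holomorphic)
  moreover have "\<delta> N w * poly y (\<pi> w) - N w * poly (pderiv y) (\<pi> w) = M w" if w: "w \<in> W" for w
  proof -
    have "\<delta> N w = - (\<delta> M w * poly b (\<pi> w) + M w * poly (pderiv b) (\<pi> w))
        + (poly (pderiv y) (\<pi> w) * F w + poly y (\<pi> w) * B w)"
      unfolding N_def[abs_def]
    proof (rule ddxI[OF w])
      note d = DERIV_ddx[OF M w] DERIV_poly_\<pi>[OF w, of b] DERIV_poly_\<pi>[OF w, of y]
        DERIV_ddx[OF F(1) w, unfolded F(2)[OF w]]
      show "((\<lambda>w. - M w * poly b (\<pi> w) + poly y (\<pi> w) * F w) has_field_derivative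
        (- (\<delta> M w * poly b (\<pi> w) + M w * poly (pderiv b) (\<pi> w))
        + (poly (pderiv y) (\<pi> w) * F w + poly y (\<pi> w) * B w)) * deriv \<pi> w) (at w)"
        by (rule DERIV_cong[OF DERIV_add[OF DERIV_mult[OF DERIV_minus[OF d(1)] d(2)] DERIV_mult[OF d(3,4)]]])
           (simp add: algebra_simps)
    qed
    note dN = this
    have "\<delta> N w * poly y (\<pi> w) - N w * poly (pderiv y) (\<pi> w) =
        poly y (\<pi> w) * (B w * poly y (\<pi> w)) - poly y (\<pi> w) * (\<delta> M w * poly b (\<pi> w) + M w * poly (pderiv b) (\<pi> w))
        + M w * (poly b (\<pi> w) * poly (pderiv y) (\<pi> w))"
      unfolding dN N_def by (simp add: algebra_simps)
    also have "\<dots> = M w * (poly a (\<pi> w) * poly y (\<pi> w) + poly b (\<pi> w) * poly (pderiv y) (\<pi> w))"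
      unfolding B(2)[OF w, symmetric] by (simp add: h_def algebra_simps)
    finally show ?thesis by (simp only: ab_at mult_1_right)
  qed
  ultimately show ?thesis using that by blast
qed

subsection \<open>Operators acting on functions\<close>

lemma dop_apply_bound:
  "degree A \<le> N \<Longrightarrow> dop_apply \<pi> A u w = (\<Sum>k\<le>N. rat_eval (coeff A k) (\<pi> w) * (\<delta> ^^ k) u w)"
  unfolding dop_apply_def by (rule sum.mono_neutral_left) (auto simp: coeff_eq_0)

lemma dop_apply_diff:
  assumes "regular_op A (\<pi> w)" "regular_op B (\<pi> w)"
  shows "dop_apply \<pi> (A - B) u w = dop_apply \<pi> A u w - dop_apply \<pi> B u w"
proof -
  define N where "N = max (degree A) (degree B)"
  have "degree (A - B) \<le> N" "degree A \<le> N" "degree B \<le> N"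
    unfolding N_def by (auto simp: degree_diff_le_max)
  then show ?thesis using assms
    by (simp add: dop_apply_bound[of _ N] regular_op_def rat_eval_diff left_diff_distrib sum_subtractf)
qed

lemma dop_apply_smult:
  assumes "regular_op A (\<pi> w)" "\<not> rat_pole q (\<pi> w)"
  shows "dop_apply \<pi> (Polynomial.smult q A) u w = rat_eval q (\<pi> w) * dop_apply \<pi> A u w"
  using assms
  by (simp add: dop_apply_bound[of _ "degree A"] degree_smult_le regular_op_def rat_eval_mult
      sum_distrib_left mult.assoc)

lemma DERIV_dop_apply:
  assumes A: "regular_op A (\<pi> w)" and u: "u holomorphic_on W" and w: "w \<in> W"
  shows "(dop_apply \<pi> A u has_field_derivative dop_apply \<pi> (ddx_comp A) u w * deriv \<pi> w) (at w)"
proof -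
  define N where "N = degree A"
  define U where "U k = (\<delta> ^^ k) u" for k
  define c where "c k = rat_eval (coeff A k) (\<pi> w)" for k
  define c' where "c' k = rat_eval (rat_deriv (coeff A k)) (\<pi> w)" for k
  have reg: "\<not> rat_pole (coeff A k) (\<pi> w)" for k using A by (simp add: regular_op_def)
  have U: "(U k has_field_derivative U (Suc k) w * deriv \<pi> w) (at w)" for k
    using DERIV_ddx[OF ddx_power_holomorphic[OF u, of k] w] by (simp add: U_def)
  have "((\<lambda>w. \<Sum>k\<le>N. rat_eval (coeff A k) (\<pi> w) * U k w) has_field_derivative
      (\<Sum>k\<le>N. c' k * deriv \<pi> w * U k w + U (Suc k) w * deriv \<pi> w * c k)) (at w)"
    unfolding c_def c'_def by (intro DERIV_sum DERIV_mult DERIV_rat_\<pi> reg w U)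
  moreover have "(\<Sum>k\<le>N. c' k * deriv \<pi> w * U k w + U (Suc k) w * deriv \<pi> w * c k) =
      ((\<Sum>k\<le>N. c k * U (Suc k) w) + (\<Sum>k\<le>N. c' k * U k w)) * deriv \<pi> w"
    unfolding sum.distrib[symmetric] sum_distrib_right
    by (intro sum.cong refl) (simp add: algebra_simps)
  moreover have "dop_apply \<pi> (ddx_comp A) u w = (\<Sum>k\<le>N. c k * U (Suc k) w) + (\<Sum>k\<le>N. c' k * U k w)"
  proof -
    have "dop_apply \<pi> (ddx_comp A) u w = (\<Sum>k\<le>Suc N. rat_eval (coeff (ddx_comp A) k) (\<pi> w) * U k w)"
      unfolding U_def N_def by (rule dop_apply_bound) (rule degree_ddx_comp)
    also have "\<dots> = (\<Sum>k\<le>Suc N. (case k of 0 \<Rightarrow> 0 | Suc j \<Rightarrow> c j) * U k w) + (\<Sum>k\<le>Suc N. c' k * U k w)"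
      unfolding sum.distrib[symmetric] c_def c'_def
      by (intro sum.cong refl)
         (simp add: coeff_ddx_comp rat_eval_add reg rat_deriv_regular distrib_right split: nat.split)
    also have "(\<Sum>k\<le>Suc N. (case k of 0 \<Rightarrow> 0 | Suc j \<Rightarrow> c j) * U k w) = (\<Sum>k\<le>N. c k * U (Suc k) w)"
      by (subst sum.atMost_Suc_shift) simp
    also have "(\<Sum>k\<le>Suc N. c' k * U k w) = (\<Sum>k\<le>N. c' k * U k w)"
      by (simp add: c'_def N_def coeff_eq_0)
    finally show ?thesis .
  qed
  moreover have "dop_apply \<pi> A u = (\<lambda>w. \<Sum>k\<le>N. rat_eval (coeff A k) (\<pi> w) * U k w)"
    unfolding U_def N_def by (rule ext) (rule dop_apply_bound[OF order_refl])
  ultimately show ?thesis by simp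
qed

lemma dop_apply_holomorphic:
  assumes "\<And>w. w \<in> W \<Longrightarrow> regular_op A (\<pi> w)" and "u holomorphic_on W"
  shows "dop_apply \<pi> A u holomorphic_on W"
  using DERIV_dop_apply[OF assms(1) assms(2)] open_W by (auto simp: holomorphic_on_open)

lemma dop_apply_factor_chain_Suc:
  assumes "regular_op (factor_chain g k) (\<pi> w)" and "\<not> rat_pole (g (Suc k)) (\<pi> w)"
    and "u holomorphic_on W" and w: "w \<in> W"
  shows "dop_apply \<pi> (factor_chain g (Suc k)) u w =
    \<delta> (dop_apply \<pi> (factor_chain g k) u) w - rat_eval (g (Suc k)) (\<pi> w) * dop_apply \<pi> (factor_chain g k) u w"
  using assms ddxI[OF w DERIV_dop_apply[OF assms(1,3) w]]
  by (simp add: dop_apply_diff dop_apply_smult regular_op_smult regular_op_ddx_comp)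

lemma wronskian_holomorphic:
  assumes "\<And>b. b \<in> {1..i} \<Longrightarrow> u b holomorphic_on W"
  shows "wronskian \<pi> i u holomorphic_on W"
proof -
  have less: "p a < i" if "p permutes {0..<i}" "a < i" for p a
    using permutes_in_image[OF that(1), of a] that(2) by simp
  have "wronskian \<pi> i u = (\<lambda>w. \<Sum>p | p permutes {0..<i}.
      signof p * (\<Prod>a = 0..<i. (\<delta> ^^ a) (u (Suc (p a))) w))"
  proof
    fix w
    show "wronskian \<pi> i u w = (\<Sum>p | p permutes {0..<i}.
        signof p * (\<Prod>a = 0..<i. (\<delta> ^^ a) (u (Suc (p a))) w))"
      unfolding wronskian_def Determinant.det_def
      by (auto intro!: sum.cong prod.cong arg_cong2[where f = "(*)"] simp: less)
  qed
  moreover have "(\<lambda>w. \<Sum>p | p permutes {0..<i}.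
      signof p * (\<Prod>a = 0..<i. (\<delta> ^^ a) (u (Suc (p a))) w)) holomorphic_on W"
  proof (intro holomorphic_intros)
    fix p a assume "p \<in> {p. p permutes {0..<i}}" "a \<in> {0..<i}"
    then have "p a < i" using less by simp
    then show "(\<delta> ^^ a) (u (Suc (p a))) holomorphic_on W"
      using assms by (intro ddx_power_holomorphic) auto
  qed
  ultimately show ?thesis by simp
qed

text \<open>Monic operators \<open>A\<^sub>a\<close> of order \<open>a\<close> act on the rows of the Wronskian matrix by a unipotent
  matrix. If they bring it to triangular form, the diagonal gives the Wronskian.\<close>

lemma wronskian_triangular:
  assumes deg: "\<And>a. a < i \<Longrightarrow> degree (A a) = a" and lead: "\<And>a. a < i \<Longrightarrow> coeff (A a) a = 1"
    and zero: "\<And>a b. b < a \<Longrightarrow> a < i \<Longrightarrow> dop_apply \<pi> (A a) (u (Suc b)) w = 0"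
  shows "wronskian \<pi> i u w = (\<Prod>a<i. dop_apply \<pi> (A a) (u (Suc a)) w)"
proof -
  define C where "C = Matrix.mat i i (\<lambda>(a, k). rat_eval (coeff (A a) k) (\<pi> w))"
  define M where "M = Matrix.mat i i (\<lambda>(a, b). (\<delta> ^^ a) (u (Suc b)) w)"
  have C: "C \<in> carrier_mat i i" and M: "M \<in> carrier_mat i i" by (simp_all add: C_def M_def)
  have CM: "(C * M) $$ (a, b) = dop_apply \<pi> (A a) (u (Suc b)) w" if "a < i" "b < i" for a b
  proof -
    have "(C * M) $$ (a, b) = (\<Sum>k<i. rat_eval (coeff (A a) k) (\<pi> w) * (\<delta> ^^ k) (u (Suc b)) w)"
      using that by (simp add: C_def M_def scalar_prod_def atLeast0LessThan)
    also have "\<dots> = dop_apply \<pi> (A a) (u (Suc b)) w"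
      unfolding dop_apply_def using that
      by (intro sum.mono_neutral_right) (auto simp: deg coeff_eq_0)
    finally show ?thesis .
  qed
  have "Determinant.det C = (\<Prod>a = 0..<i. C $$ (a, a))"
    using C det_lower_triangular[of i C] by (simp add: prod_list_diag_prod C_def deg coeff_eq_0)
  also have "\<dots> = 1" by (simp add: C_def lead)
  finally have "Determinant.det C = 1" .
  moreover have "Determinant.det (C * M) = (\<Prod>a<i. dop_apply \<pi> (A a) (u (Suc a)) w)"
  proof -
    have "upper_triangular (C * M)" unfolding upper_triangular_def
      using C M zero CM by simp
    then have "Determinant.det (C * M) = (\<Prod>a = 0..<i. (C * M) $$ (a, a))"
      using det_upper_triangular[of "C * M" i] C M by (simp add: prod_list_diag_prod)
    also have "\<dots> = (\<Prod>a<i. dop_apply \<pi> (A a) (u (Suc a)) w)"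
      by (simp add: CM atLeast0LessThan)
    finally show ?thesis .
  qed
  ultimately show ?thesis
    using det_mult[OF C M] by (simp add: wronskian_def M_def)
qed

end

section \<open>Solutions of the fundamental differential equation\<close>

text \<open>Differentiating \<open>exp L\<^sub>s = \<pi> - z\<^sub>s\<close> shows that \<open>L\<^sub>s\<close> has the derivative \<open>1/(x - z\<^sub>s)\<close> with respect to
  \<open>x = \<pi>(w)\<close>.\<close>

lemma (in surface) power_product_branch_facts:
  assumes T: "power_product_branch W \<pi> n z e T" and avoid: "\<pi> ` W \<subseteq> - (z ` {1..n})"
  shows "T holomorphic_on W" and "w \<in> W \<Longrightarrow> T w \<noteq> 0"
    and "w \<in> W \<Longrightarrow> \<delta> T w = (\<Sum>s=1..n. e s / (\<pi> w - z s)) * T w"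
proof -
  obtain L where L: "\<And>s. s \<in> {1..n} \<Longrightarrow> L s holomorphic_on W"
      "\<And>s w. s \<in> {1..n} \<Longrightarrow> w \<in> W \<Longrightarrow> exp (L s w) = \<pi> w - z s"
      "\<And>w. w \<in> W \<Longrightarrow> T w = (\<Prod>s=1..n. exp (e s * L s w))"
    using T unfolding power_product_branch_def by metis
  have L': "(L s has_field_derivative deriv \<pi> w / (\<pi> w - z s)) (at w)" if s: "s \<in> {1..n}" and w: "w \<in> W" for s w
  proof -
    have "L s holomorphic_on W" using L(1) s .
    then have D: "(L s has_field_derivative deriv (L s) w) (at w)"
      using holomorphic_derivI[OF _ open_W w] by blast
    have "((\<lambda>w. exp (L s w)) has_field_derivative exp (L s w) * deriv (L s) w) (at w)"
      using D by (auto intro!: derivative_eq_intros)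
    then have "((\<lambda>w. \<pi> w - z s) has_field_derivative exp (L s w) * deriv (L s) w) (at w)"
      by (rule has_field_derivative_transform_within_open[OF _ open_W w]) (rule L(2)[OF s])
    moreover have "((\<lambda>w. \<pi> w - z s) has_field_derivative deriv \<pi> w) (at w)"
      using DERIV_\<pi>[OF w] by (auto intro!: derivative_eq_intros)
    ultimately have "(\<pi> w - z s) * deriv (L s) w = deriv \<pi> w"
      using DERIV_unique L(2)[OF s w] by fastforce
    moreover have "\<pi> w - z s \<noteq> 0" using L(2)[OF s w] by (metis exp_not_eq_zero)
    ultimately have "deriv (L s) w = deriv \<pi> w / (\<pi> w - z s)" by (simp add: field_simps)
    then show ?thesis using D by simp
  qed
  have D: "(T has_field_derivative (\<Sum>s=1..n. e s / (\<pi> w - z s)) * T w * deriv \<pi> w) (at w)" if w: "w \<in> W" for w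
  proof -
    have "((\<lambda>w. exp (\<Sum>s=1..n. e s * L s w)) has_field_derivative
        exp (\<Sum>s=1..n. e s * L s w) * (\<Sum>s=1..n. e s * (deriv \<pi> w / (\<pi> w - z s)))) (at w)"
      by (intro DERIV_fun_exp DERIV_sum DERIV_cmult L' w)
    moreover have ex: "exp (\<Sum>s=1..n. e s * L s w) = T w" if "w \<in> W" for w
      using L(3)[OF that] by (simp add: exp_sum)
    ultimately have "(T has_field_derivative
        exp (\<Sum>s=1..n. e s * L s w) * (\<Sum>s=1..n. e s * (deriv \<pi> w / (\<pi> w - z s)))) (at w)"
      by (rule has_field_derivative_transform_within_open[OF _ open_W w])
    moreover have "exp (\<Sum>s=1..n. e s * L s w) * (\<Sum>s=1..n. e s * (deriv \<pi> w / (\<pi> w - z s))) =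
        (\<Sum>s=1..n. e s / (\<pi> w - z s)) * T w * deriv \<pi> w"
      unfolding ex[OF w] sum_distrib_left sum_distrib_right by (intro sum.cong refl) simp
    ultimately show ?thesis by simp
  qed
  then show "T holomorphic_on W" using open_W by (auto simp: holomorphic_on_open)
  show "T w \<noteq> 0" if "w \<in> W" using L(3)[OF that] by simp
  show "\<delta> T w = (\<Sum>s=1..n. e s / (\<pi> w - z s)) * T w" if "w \<in> W"
    using ddxI[OF that D[OF that]] .
qed

locale critical_surface = critical r n z \<Lambda> l t + surface W \<pi>
  for r n z \<Lambda> l t W \<pi> +
  fixes T :: "nat \<Rightarrow> complex \<Rightarrow> complex"
  assumes avoid: "\<pi> ` W \<subseteq> - (z ` {1..n})"
    and T_branch: "i \<in> {1..r+1} \<Longrightarrow> power_product_branch W \<pi> n z (\<lambda>s. - \<Lambda> s i) (T i)"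
begin

lemmas T_holomorphic = power_product_branch_facts(1)[OF T_branch avoid]
lemmas T_nonzero = power_product_branch_facts(2)[OF T_branch avoid]
lemmas ddx_T = power_product_branch_facts(3)[OF T_branch avoid]

abbreviation y_at :: "nat \<Rightarrow> complex \<Rightarrow> complex" where
  "y_at i w \<equiv> poly (y i) (\<pi> w)"

abbreviation y'_at :: "nat \<Rightarrow> complex \<Rightarrow> complex" where
  "y'_at i w \<equiv> poly (pderiv (y i)) (\<pi> w)"

lemma \<pi>_avoid: "w \<in> W \<Longrightarrow> \<pi> w \<notin> z ` {1..n}"
  using avoid by auto

lemma y_coprime: "coprime (y i) (pderiv (y i))"
proof -
  have no_common_root: False if p: "poly (y i) p = 0" "poly (pderiv (y i)) p = 0" for p
  proof -
    obtain q where "y i = [:- p, 1:] * q" "poly q p \<noteq> 0"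
      using y_simple_root[OF p(1)] by metis
    then have "poly (pderiv (y i)) p = poly q p" 
      by (simp add: pderiv_mult pderiv_pCons del: mult_pCons_left mult_pCons_right)
    then show False using p \<open>poly q p \<noteq> 0\<close> by simp
  qed
  show ?thesis
  proof (rule coprimeI)
    fix c assume c: "c dvd y i" "c dvd pderiv (y i)"
    then have "c \<noteq> 0" using y_poly_nonzero by auto
    have "degree c = 0"
    proof (rule ccontr)
      assume "degree c \<noteq> 0"
      then obtain p where "poly c p = 0"
        using fundamental_theorem_of_algebra[of c] by (auto simp: constant_degree)
      then show False using c no_common_root dvd_trans poly_eq_0_iff_dvd by metis
    qed
    then show "is_unit c" using \<open>c \<noteq> 0\<close> by (simp add: is_unit_iff_degree)
  qed
qed

text \<open>The functions \<open>N\<^sub>k\<close> are built downwards from \<open>N\<^sub>i = y\<^sub>i\<close>. The equation for \<open>N\<^sub>k\<^sub>+\<^sub>1\<close> has a right-hand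
  side divisible by \<open>y\<^sub>k\<close>, so \<open>N\<^sub>k\<^sub>+\<^sub>1\<close> and \<open>y\<^sub>k\<^sub>+\<^sub>1\<close> have the same logarithmic derivative at the zeros of
  \<open>y\<^sub>k\<close>. Together with the critical point equation this is the residue condition for the next
  step.\<close>

lemma numerators_exist:
  assumes i: "i \<in> {1..r+1}"
  obtains N where "N i = y_at i" and "\<And>k. k \<in> {1..i} \<Longrightarrow> N k holomorphic_on W"
    and "\<And>k w. k \<in> {1..<i} \<Longrightarrow> w \<in> W \<Longrightarrow>
      \<delta> (N k) w * y_at k w - N k w * y'_at k w = N (Suc k) w * y_at (k - 1) w * T (Suc k) w / T k w"
proof -
  define rel where "rel N k \<longleftrightarrow> (\<forall>w\<in>W. \<delta> (N k) w * y_at k w - N k w * y'_at k w =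
      N (Suc k) w * y_at (k - 1) w * T (Suc k) w / T k w)" for N k
  define ok where "ok m N \<longleftrightarrow> N i = y_at i \<and> (\<forall>k\<in>{m..i}. N k holomorphic_on W) \<and> (\<forall>k\<in>{m..<i}. rel N k)"
    for m N
  have "1 \<le> i" using i by simp
  then have "\<exists>N. ok 1 N"
  proof (induction rule: inc_induct)
    case base
    have "ok i (\<lambda>k. y_at k)" by (simp add: ok_def poly_\<pi>_holomorphic)
    then show ?case by blast
  next
    case (step k)
    then obtain N where N: "ok (Suc k) N" by blast
    have k: "k \<in> {1..r}" "Suc k \<in> {1..r+1}" "k \<in> {1..r+1}" using step i by auto
    define M where "M w = N (Suc k) w * y_at (k - 1) w * T (Suc k) w / T k w" for w
    have Nk: "N (Suc k) holomorphic_on W" using N step by (auto simp: ok_def)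
    have M: "M holomorphic_on W" unfolding M_def
      using T_nonzero[OF k(3)]
      by (intro holomorphic_intros Nk poly_\<pi>_holomorphic T_holomorphic k) auto
    have res: "\<delta> M w * y'_at k w = M w * poly (pderiv (pderiv (y k))) (\<pi> w)"
      if w: "w \<in> W" "y_at k w = 0" for w
    proof -
      have n: "\<delta> (N (Suc k)) w * y_at (Suc k) w = N (Suc k) w * y'_at (Suc k) w"
      proof (cases "Suc k = i")
        case True
        then show ?thesis using N ddx_poly[OF w(1)] by (simp add: ok_def)
      next
        case False
        then have "rel N (Suc k)" using N step by (simp add: ok_def)
        then have "\<delta> (N (Suc k)) w * y_at (Suc k) w - N (Suc k) w * y'_at (Suc k) w = 0"
          using w by (simp add: rel_def)
        then show ?thesis by simp
      qed
      have ny: "y_at (Suc k) w \<noteq> 0" "y_at (k - 1) w \<noteq> 0"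
        using y_neighbours[of k "\<pi> w"] y_neighbours[of "k - 1" "\<pi> w"] w(2) k(1) by auto
      have n': "\<delta> (N (Suc k)) w = N (Suc k) w * (y'_at (Suc k) w / y_at (Suc k) w)"
        using n ny by (simp add: field_simps)
      have Tn: "T k w \<noteq> 0" using T_nonzero[OF k(3) w(1)] .
      define a where "a = (\<Sum>s=1..n. - \<Lambda> s (Suc k) / (\<pi> w - z s))"
      define b where "b = (\<Sum>s=1..n. - \<Lambda> s k / (\<pi> w - z s))"
      have "\<delta> M w = ((\<delta> (N (Suc k)) w * y_at (k - 1) w + N (Suc k) w * y'_at (k - 1) w) * T (Suc k) w
          + N (Suc k) w * y_at (k - 1) w * (a * T (Suc k) w)) / T k w
          - N (Suc k) w * y_at (k - 1) w * T (Suc k) w * (b * T k w) / (T k w * T k w)"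
        unfolding M_def[abs_def]
      proof (rule ddxI[OF w(1)])
        note d = DERIV_ddx[OF Nk w(1)] DERIV_poly_\<pi>[OF w(1), of "y (k - 1)"]
          DERIV_ddx[OF T_holomorphic[OF k(2)] w(1), unfolded ddx_T[OF k(2) w(1)], folded a_def]
          DERIV_ddx[OF T_holomorphic[OF k(3)] w(1), unfolded ddx_T[OF k(3) w(1)], folded b_def]
        show "((\<lambda>w. N (Suc k) w * y_at (k - 1) w * T (Suc k) w / T k w) has_field_derivative
          (((\<delta> (N (Suc k)) w * y_at (k - 1) w + N (Suc k) w * y'_at (k - 1) w) * T (Suc k) w
          + N (Suc k) w * y_at (k - 1) w * (a * T (Suc k) w)) / T k w
          - N (Suc k) w * y_at (k - 1) w * T (Suc k) w * (b * T k w) / (T k w * T k w)) * deriv \<pi> w) (at w)"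
          by (rule DERIV_cong[OF DERIV_divide[OF DERIV_mult[OF DERIV_mult[OF d(1,2)] d(3)] d(4) Tn]])
             (use Tn in \<open>simp add: field_simps\<close>)
      qed
      also have "\<dots> = M w * (y'_at (k - 1) w / y_at (k - 1) w + y'_at (Suc k) w / y_at (Suc k) w + a - b)"
      proof -
        have "((N1 * P * y0 + N1 * (Q * y0)) * T1 + N1 * y0 * (a * T1)) / T0 - N1 * y0 * T1 * (b * T0) / (T0 * T0)
            = N1 * y0 * T1 / T0 * (Q + P + a - b)" if "T0 \<noteq> 0" for N1 P Q y0 T0 T1 :: complex
          using that by (simp add: field_simps)
        from this[OF Tn, of "N (Suc k) w" "y'_at (Suc k) w / y_at (Suc k) w" "y_at (k - 1) w"
            "y'_at (k - 1) w / y_at (k - 1) w" "T (Suc k) w"]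
        show ?thesis unfolding n' M_def using ny(2) by simp
      qed
      finally have "\<delta> M w = \<dots>" .
      then show ?thesis
        using bethe_polynomials[OF w(2) \<pi>_avoid[OF w(1)], folded a_def b_def] by simp
    qed
    obtain N' where N': "N' holomorphic_on W"
        "\<And>w. w \<in> W \<Longrightarrow> \<delta> N' w * y_at k w - N' w * y'_at k w = M w"
      by (rule wronskian_equation_solvable[OF y_coprime M res]) (assumption | rule that; assumption)+
    have rel: "rel (N(k := N')) k'" if "k' \<in> {k..<i}" for k'
    proof (cases "k' = k")
      case True
      then show ?thesis using N'(2) by (simp add: rel_def M_def)
    next
      case False
      then have "rel N k'" using N that by (simp add: ok_def)
      then show ?thesis using False that by (simp add: rel_def)
    qed
    have "(N(k := N')) k' holomorphic_on W" if "k' \<in> {k..i}" for k'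
      using N N'(1) that by (cases "k' = k") (simp_all add: ok_def)
    then have "ok k (N(k := N'))" using rel N step by (simp add: ok_def)
    then show ?case by blast
  qed
  then obtain N where N: "ok 1 N" by blast
  show ?thesis by (rule that[of N]) (use N in \<open>simp_all add: ok_def rel_def\<close>)
qed

text \<open>\<open>u = T\<^sub>1 N\<^sub>1\<close> is the solution: off the zeros of the \<open>y\<^sub>k\<close>, the first \<open>k\<close> factors of the operator
  turn it into \<open>T\<^sub>k\<^sub>+\<^sub>1 N\<^sub>k\<^sub>+\<^sub>1 / y\<^sub>k\<close> if \<open>k < i\<close>. For \<open>k = i - 1\<close> this is \<open>y\<^sub>i T\<^sub>i / y\<^sub>i\<^sub>-\<^sub>1\<close>, which the \<open>i\<close>-th factor
  annihilates.\<close>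

lemma solution_exists:
  assumes i: "i \<in> {1..r+1}"
  obtains u where "u holomorphic_on W" and "i = 1 \<Longrightarrow> u = (\<lambda>w. y_at 1 w * T 1 w)"
    and "\<And>w k. w \<in> W \<Longrightarrow> (\<And>m. y_at m w \<noteq> 0) \<Longrightarrow> k \<in> {i..r+1} \<Longrightarrow> dop_apply \<pi> (factor_chain g k) u w = 0"
    and "\<And>w. w \<in> W \<Longrightarrow> (\<And>m. y_at m w \<noteq> 0) \<Longrightarrow>
      dop_apply \<pi> (factor_chain g (i - 1)) u w = y_at i w * T i w / y_at (i - 1) w"
proof -
  obtain N where N: "N i = y_at i" "\<And>k. k \<in> {1..i} \<Longrightarrow> N k holomorphic_on W"
    "\<And>k w. k \<in> {1..<i} \<Longrightarrow> w \<in> W \<Longrightarrow>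
      \<delta> (N k) w * y_at k w - N k w * y'_at k w = N (Suc k) w * y_at (k - 1) w * T (Suc k) w / T k w"
    by (rule numerators_exist[OF i]) (rule that; assumption)
  define u where "u w = N 1 w * T 1 w" for w
  have u: "u holomorphic_on W" unfolding u_def
    using i by (intro holomorphic_intros N(2) T_holomorphic) auto
  define V where "V k w = (if k < i then T (Suc k) w * N (Suc k) w / y_at k w else 0)" for k w
  define good where "good = {w \<in> W. \<forall>m\<in>{1..r}. y_at m w \<noteq> 0}"
  have y_good: "y_at m w \<noteq> 0" if "w \<in> good" for m w
    using that y_outside[of m] by (cases "m \<in> {1..r}") (auto simp: good_def)
  have "good = {w \<in> W. poly (\<Prod>m=1..r. y m) (\<pi> w) \<noteq> 0}"
    by (auto simp: good_def poly_prod)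
  then have good: "open good" "good \<subseteq> W"
    using poly_nonzero_open by (auto simp: good_def)
  have reg: "regular_op (factor_chain g k) (\<pi> w)" if w: "w \<in> good" for k w
  proof (induction k)
    case (Suc k)
    then show ?case
      using factor_regular[OF \<pi>_avoid y_good[OF w] y_good[OF w], of "Suc k"] w good
      by (auto simp: regular_op_diff regular_op_smult regular_op_ddx_comp)
  qed (simp add: regular_op_1)
  have V: "dop_apply \<pi> (factor_chain g k) u w = V k w" if "w \<in> good" "k \<le> r + 1" for k w
    using that
  proof (induction k arbitrary: w)
    case 0
    then show ?case using i by (simp add: V_def u_def dop_apply_def y_outside)
  next
    case (Suc k)
    then have w: "w \<in> W" using good by blast
    define a where "a = (\<Sum>s=1..n. - \<Lambda> s (Suc k) / (\<pi> w - z s))"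
    have g: "\<not> rat_pole (g (Suc k)) (\<pi> w)"
      "rat_eval (g (Suc k)) (\<pi> w) = y'_at (Suc k) w / y_at (Suc k) w - y'_at k w / y_at k w + a"
      using factor_regular[OF \<pi>_avoid[OF w] y_good[OF Suc(2)] y_good[OF Suc(2)], of "Suc k"]
      by (auto simp: a_def)
    have "dop_apply \<pi> (factor_chain g (Suc k)) u w =
        \<delta> (dop_apply \<pi> (factor_chain g k) u) w - rat_eval (g (Suc k)) (\<pi> w) * dop_apply \<pi> (factor_chain g k) u w"
      by (rule dop_apply_factor_chain_Suc[OF reg[OF Suc(2)] g(1) u w])
    also have "\<delta> (dop_apply \<pi> (factor_chain g k) u) w = \<delta> (V k) w"
      using good Suc by (intro ddx_cong[of good]) auto
    also have "dop_apply \<pi> (factor_chain g k) u w = V k w" using Suc by simp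
    finally have e: "dop_apply \<pi> (factor_chain g (Suc k)) u w = \<delta> (V k) w - rat_eval (g (Suc k)) (\<pi> w) * V k w" .
    show ?case
    proof (cases "k < i")
      case False
      then have "V k = (\<lambda>w. 0)" "V (Suc k) w = 0" by (auto simp: V_def)
      then show ?thesis using e by (simp add: ddx_on_def)
    next
      case True
      have k: "Suc k \<in> {1..r+1}" "Suc k \<in> {1..i}" using True Suc i by auto
      have Tn: "T (Suc k) w \<noteq> 0" using T_nonzero[OF k(1) w] .
      note yn = y_good[OF Suc(2)]
      have Vk: "V k = (\<lambda>w. T (Suc k) w * N (Suc k) w / y_at k w)" using True by (auto simp: V_def)
      have "\<delta> (V k) w = (a * T (Suc k) w * N (Suc k) w + T (Suc k) w * \<delta> (N (Suc k)) w) / y_at k w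
          - T (Suc k) w * N (Suc k) w * y'_at k w / (y_at k w * y_at k w)"
      proof (rule ddxI[OF w])
        note d = DERIV_ddx[OF T_holomorphic[OF k(1)] w, unfolded ddx_T[OF k(1) w], folded a_def]
          DERIV_ddx[OF N(2)[OF k(2)] w] DERIV_poly_\<pi>[OF w, of "y k"]
        show "(V k has_field_derivative
            ((a * T (Suc k) w * N (Suc k) w + T (Suc k) w * \<delta> (N (Suc k)) w) / y_at k w
            - T (Suc k) w * N (Suc k) w * y'_at k w / (y_at k w * y_at k w)) * deriv \<pi> w) (at w)"
          unfolding Vk
          by (rule DERIV_cong[OF DERIV_divide[OF DERIV_mult[OF d(1,2)] d(3) yn]])
             (use yn in \<open>simp add: field_simps\<close>)
      qed
      note dV = this
      have "dop_apply \<pi> (factor_chain g (Suc k)) u w =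
          T (Suc k) w * (\<delta> (N (Suc k)) w * y_at (Suc k) w - N (Suc k) w * y'_at (Suc k) w)
            / (y_at k w * y_at (Suc k) w)"
        unfolding e g(2) dV unfolding Vk using yn[of k] yn[of "Suc k"] by (simp add: field_simps)
      also have "\<dots> = V (Suc k) w"
      proof (cases "Suc k = i")
        case True
        then show ?thesis using N(1) ddx_poly[OF w] by (simp add: V_def)
      next
        case False
        then have "Suc k \<in> {1..<i}" using True by simp
        from N(3)[OF this w] show ?thesis
          using False True Tn yn[of k] yn[of "Suc k"] by (simp add: V_def)
      qed
      finally show ?thesis .
    qed
  qed
  have good_iff: "w \<in> good" if "w \<in> W" "\<And>m. y_at m w \<noteq> 0" for w
    using that by (simp add: good_def)
  show ?thesis
  proof (rule that[OF u])
    show "u = (\<lambda>w. y_at 1 w * T 1 w)" if "i = 1" using N(1) that by (auto simp: u_def)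
    show "dop_apply \<pi> (factor_chain g k) u w = 0" if "w \<in> W" "\<And>m. y_at m w \<noteq> 0" "k \<in> {i..r+1}" for w k
      using V[OF good_iff[OF that(1,2)], of k] that(3) by (simp add: V_def)
    show "dop_apply \<pi> (factor_chain g (i - 1)) u w = y_at i w * T i w / y_at (i - 1) w"
      if "w \<in> W" "\<And>m. y_at m w \<noteq> 0" for w
    proof -
      have "i - 1 < i" "i - 1 \<le> r + 1" "Suc (i - 1) = i" using i by auto
      then show ?thesis using V[OF good_iff[OF that], of "i - 1"] N(1) by (simp add: V_def mult.commute)
    qed
  qed
qed

text \<open>Both properties follow off the zeros of the \<open>y\<^sub>m\<close>, where the factors can be applied one by one. They
  extend to all of \<open>W\<close> because both sides are holomorphic on \<open>W\<close>; for the operator this needs that its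
  coefficients have no poles there.\<close>

lemma solutions_with_wronskians:
  obtains u where "\<And>i. i \<in> {1..r+1} \<Longrightarrow> solution_on W \<pi> (factor_chain g (Suc r)) (u i)"
    and "\<And>w. w \<in> W \<Longrightarrow> u 1 w = y_at 1 w * T 1 w"
    and "\<And>i w. i \<in> {1..r+1} \<Longrightarrow> w \<in> W \<Longrightarrow> wronskian \<pi> i u w = y_at i w * (\<Prod>k=1..i. T k w)"
proof -
  define sol where "sol i v \<longleftrightarrow> v holomorphic_on W \<and> (i = 1 \<longrightarrow> v = (\<lambda>w. y_at 1 w * T 1 w)) \<and>
      (\<forall>w\<in>W. (\<forall>m. y_at m w \<noteq> 0) \<longrightarrow> (\<forall>k\<in>{i..r+1}. dop_apply \<pi> (factor_chain g k) v w = 0) \<and>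
        dop_apply \<pi> (factor_chain g (i - 1)) v w = y_at i w * T i w / y_at (i - 1) w)" for i v
  have "\<forall>i\<in>{1..r+1}. \<exists>v. sol i v"
  proof
    fix i assume i: "i \<in> {1..r+1}"
    show "\<exists>v. sol i v" by (rule solution_exists[OF i]) (auto simp: sol_def)
  qed
  then obtain u where sol: "\<And>i. i \<in> {1..r+1} \<Longrightarrow> sol i (u i)" by metis
  have u: "u i holomorphic_on W" if "i \<in> {1..r+1}" for i
    using sol[OF that] by (simp add: sol_def)
  have u1: "u 1 = (\<lambda>w. y_at 1 w * T 1 w)"
    using sol[of 1] by (simp add: sol_def)
  have annihilated: "dop_apply \<pi> (factor_chain g k) (u i) w = 0"
    if "i \<in> {1..r+1}" "w \<in> W" "\<And>m. y_at m w \<noteq> 0" "k \<in> {i..r+1}" for i w k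
    using sol[OF that(1)] that(2-) unfolding sol_def by blast
  have diagonal: "dop_apply \<pi> (factor_chain g (i - 1)) (u i) w = y_at i w * T i w / y_at (i - 1) w"
    if "i \<in> {1..r+1}" "w \<in> W" "\<And>m. y_at m w \<noteq> 0" for i w
    using sol[OF that(1)] that(2-) unfolding sol_def by blast
  define Y where "Y = (\<Prod>m=1..r. y m)"
  have "Y \<noteq> 0" by (simp add: Y_def)
  have Y: "y_at m w \<noteq> 0" if "poly Y (\<pi> w) \<noteq> 0" for m w
    using that y_outside[of m] by (cases "m \<in> {1..r}") (auto simp: Y_def poly_prod)
  show ?thesis
  proof (rule that)
    fix i assume i: "i \<in> {1..r+1}"
    show "solution_on W \<pi> (factor_chain g (Suc r)) (u i)"
      unfolding solution_on_def
    proof (intro conjI ballI)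
      show "u i holomorphic_on W" using u i .
      have D: "dop_apply \<pi> (factor_chain g (Suc r)) (u i) holomorphic_on W"
        by (intro dop_apply_holomorphic fundamental_regular \<pi>_avoid u i)
      show "dop_apply \<pi> (factor_chain g (Suc r)) (u i) w = 0" if w: "w \<in> W" for w
      proof (rule agree_off_zeros[OF \<open>Y \<noteq> 0\<close> D holomorphic_on_const _ w])
        show "dop_apply \<pi> (factor_chain g (Suc r)) (u i) x = 0" if "x \<in> W" "poly Y (\<pi> x) \<noteq> 0" for x
          using i by (intro annihilated[OF i that(1) Y[OF that(2)]]) simp
      qed
    qed
    fix w assume w: "w \<in> W"
    have off: "wronskian \<pi> i u x = y_at i x * (\<Prod>k=1..i. T k x)" if x: "x \<in> W" "poly Y (\<pi> x) \<noteq> 0" for x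
    proof -
      have "wronskian \<pi> i u x = (\<Prod>a<i. dop_apply \<pi> (factor_chain g a) (u (Suc a)) x)"
      proof (rule wronskian_triangular)
        show "dop_apply \<pi> (factor_chain g a) (u (Suc b)) x = 0" if "b < a" "a < i" for a b
          using that i x(1) Y[OF x(2)] by (intro annihilated) auto
      qed simp_all
      also have "\<dots> = (\<Prod>a<i. y_at (Suc a) x * T (Suc a) x / y_at a x)"
        using diagonal[OF _ x(1) Y[OF x(2)], of "Suc _"] i by (intro prod.cong refl) simp
      also have "\<dots> = y_at i x * (\<Prod>k=1..i. T k x)"
      proof -
        have "(\<Prod>a<m. y_at (Suc a) x * T (Suc a) x / y_at a x) = y_at m x * (\<Prod>k=1..m. T k x)" for m
          using Y[OF x(2)] by (induction m) (simp_all add: y_outside prod.nat_ivl_Suc')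
        then show ?thesis .
      qed
      finally show ?thesis .
    qed
    show "wronskian \<pi> i u w = y_at i w * (\<Prod>k=1..i. T k w)"
    proof (rule agree_off_zeros[OF \<open>Y \<noteq> 0\<close> _ _ off w])
      show "wronskian \<pi> i u holomorphic_on W" using i by (intro wronskian_holomorphic u) auto
      show "(\<lambda>w. y_at i w * (\<Prod>k=1..i. T k w)) holomorphic_on W"
        using i by (intro holomorphic_intros poly_\<pi>_holomorphic T_holomorphic) auto
    qed
  next
    show "u 1 w = y_at 1 w * T 1 w" for w by (simp only: u1)
  qed
qed

end

theorem theorem3p1:
  fixes r n :: nat
    and z :: "nat \<Rightarrow> complex"
    and \<Lambda> :: "nat \<Rightarrow> weight"
    and l :: "nat \<Rightarrow> nat"
    and t :: "nat \<Rightarrow> nat \<Rightarrow> complex"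
  defines "D \<equiv> fundamental_operator r n z \<Lambda> l t"
  assumes "r \<ge> 1" and "n \<ge> 1"
    and "inj_on z {1..n}"
    and "separating r n \<Lambda> l"
    and "critical_point r n z \<Lambda> l t"
  shows
    "(\<forall>P. singular_point D P \<longrightarrow>
        regular_singular_point D P \<and> P \<in> Pt ` z ` {1..n} \<union> {Infty}) \<and>
     (\<forall>s\<in>{1..n}. exponents D (Pt (z s)) =
        image_mset (\<lambda>i. - \<Lambda> s i + of_nat (i - 1)) (mset_set {1..r+1})) \<and>
     exponents D Infty =
        image_mset (\<lambda>i. Lambda_infty r n \<Lambda> l i - of_nat (i - 1)) (mset_set {1..r+1}) \<and>
     (\<forall>W \<pi> T. sheet_over (- (z ` {1..n})) W \<pi> \<and>
        (\<forall>i\<in>{1..r+1}. power_product_branch W \<pi> n z (\<lambda>s. - \<Lambda> s i) (T i)) \<longrightarrow>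
        (\<exists>u. (\<forall>i\<in>{1..r+1}. solution_on W \<pi> D (u i)) \<and>
             (\<forall>w\<in>W. u 1 w = poly (y_poly r l t 1) (\<pi> w) * T 1 w) \<and>
             (\<forall>i\<in>{2..r+1}. \<forall>w\<in>W.
                wronskian \<pi> i u w = poly (y_poly r l t i) (\<pi> w) * (\<Prod>k=1..i. T k w))))"
proof -
  interpret critical r n z \<Lambda> l t by standard fact+
  have D: "D = factor_chain g (Suc r)" unfolding D_def by (rule fundamental_operator_eq)
  have "\<exists>u. (\<forall>i\<in>{1..r+1}. solution_on W \<pi> D (u i)) \<and>
             (\<forall>w\<in>W. u 1 w = poly (y_poly r l t 1) (\<pi> w) * T 1 w) \<and>
             (\<forall>i\<in>{2..r+1}. \<forall>w\<in>W.
                wronskian \<pi> i u w = poly (y_poly r l t i) (\<pi> w) * (\<Prod>k=1..i. T k w))"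
    if sheet: "sheet_over (- (z ` {1..n})) W \<pi>"
      and T: "\<forall>i\<in>{1..r+1}. power_product_branch W \<pi> n z (\<lambda>s. - \<Lambda> s i) (T i)" for W \<pi> T
  proof -
    interpret critical_surface r n z \<Lambda> l t W \<pi> T
      using sheet T by unfold_locales (auto simp: sheet_over_def)
    obtain u where "\<And>i. i \<in> {1..r+1} \<Longrightarrow> solution_on W \<pi> (factor_chain g (Suc r)) (u i)"
      "\<And>w. w \<in> W \<Longrightarrow> u 1 w = y_at 1 w * T 1 w"
      "\<And>i w. i \<in> {1..r+1} \<Longrightarrow> w \<in> W \<Longrightarrow> wronskian \<pi> i u w = y_at i w * (\<Prod>k=1..i. T k w)"
      by (rule solutions_with_wronskians) (rule that; assumption)
    then show ?thesis unfolding D by (intro exI[of _ u]) auto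
  qed
  then show ?thesis
    unfolding D using regular_singular_points exponents_at_z exponents_at_infinity by blast
qed

end
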